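(* Let $K$ be a quadratic number field with ring of integers $\mathcal{O}_K$, and let $r,m,s,t\in\mathbb{Z}_{\geq 0}$. Let $\mathbf{X}=(X_1,\ldots,X_r)$ and $\mathbf{Y}=(Y_1,\ldots,Y_m)$ be unknowns. Given $$P_1,\ldots,P_s,R_1,\ldots,R_t\in\mathbb{Z}[\mathbf{X},\mathbf{Y}],$$ there is an effectively constructible polynomial $$H(\mathbf{X},\mathbf{Y},U,V,J)\in\mathbb{Z}[\mathbf{X},\mathbf{Y},U,V,J]$$ such that, for every $\mathbf{a}\in\mathcal{O}_K^r$, the following are equivalent: (i) there exists $(\mathbf{b},u,v,j)\in\mathcal{O}_K^{m+3}$ (with $\mathbf{b}\in\mathcal{O}_K^m$ and $u,v,j\in\mathcal{O}_K$) such that $H(\mathbf{a},\mathbf{b},u,v,j)=0$; (ii) $\mathbf{a}\in\mathbb{Z}^r$ and there exists $\mathbf{b}\in\mathbb{Z}^m$ such that $P_1(\mathbf{a},\mathbf{b})=\cdots=P_s(\mathbf{a},\mathbf{b})=0$ and $R_1(\mathbf{a},\mathbf{b})\cdots R_t(\mathbf{a},\mathbf{b})\neq 0$. Here the equality condition is vacuous if $s=0$, and the product is $1$ if $t=0$.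
   Context: Convention: $\mathbb{Z}^0$ and $\mathcal{O}_K^0$ consist of a single empty tuple. "Effectively constructible" means that there is an algorithm which, given $K$ (e.g. via the squarefree integer $D\neq 0,1$ with $K=\mathbb{Q}(\sqrt{D})$), $r,m,s,t$ and the polynomials $P_i,R_j$, outputs $H$. *)

theory Defs
  imports
    "HOL-Analysis.Analysis"
    "HOL-Computational_Algebra.Squarefree"
    "HOL-Library.Poly_Mapping"
    "HOL-Library.Nat_Bijection"
begin

text \<open>
  Number fields are taken inside the complex numbers, which is no restriction up to isomorphism.
  For the closure under \<open>inverse\<close> recall that \<open>inverse 0 = 0\<close>.
\<close>

definition complex_subfield :: "complex set \<Rightarrow> bool" where
  "complex_subfield K \<longleftrightarrow>
     1 \<in> K \<and> (\<forall>x\<in>K. \<forall>y\<in>K. x - y \<in> K \<and> x * y \<in> K) \<and> (\<forall>x\<in>K. inverse x \<in> K)"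

definition rat_scale :: "rat \<Rightarrow> complex \<Rightarrow> complex" where
  "rat_scale q x = of_rat q * x"

interpretation rat_vs: vector_space rat_scale
  by standard (simp_all add: rat_scale_def algebra_simps of_rat_add of_rat_mult)

definition quadratic_number_field :: "complex set \<Rightarrow> bool" where
  "quadratic_number_field K \<longleftrightarrow> complex_subfield K \<and> rat_vs.dim K = 2"

definition rat_adjoin_sqrt :: "int \<Rightarrow> complex set" where
  "rat_adjoin_sqrt D = {of_rat p + of_rat q * csqrt (of_int D) | p q. True}"

definition ring_of_integers :: "complex set \<Rightarrow> complex set" where
  "ring_of_integers K = {x \<in> K. algebraic_int x}"

text \<open>
  A polynomial maps each monomial to its coefficient; a monomial maps each (index of a)
  variable to its exponent.
\<close>

type_synonym int_mpoly = "(nat \<Rightarrow>\<^sub>0 nat) \<Rightarrow>\<^sub>0 int"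

definition int_polys :: "nat \<Rightarrow> int_mpoly set" where
  "int_polys n = {p. \<forall>e\<in>Poly_Mapping.keys p. Poly_Mapping.keys e \<subseteq> {..<n}}"

definition eval_mpoly :: "int_mpoly \<Rightarrow> complex list \<Rightarrow> complex" where
  "eval_mpoly p xs =
     (\<Sum>e\<in>Poly_Mapping.keys p. of_int (Poly_Mapping.lookup p e) *
        (\<Prod>i\<in>Poly_Mapping.keys e. (xs ! i) ^ Poly_Mapping.lookup e i))"

definition tuples :: "'a set \<Rightarrow> nat \<Rightarrow> 'a list set" where
  "tuples A n = {xs. length xs = n \<and> set xs \<subseteq> A}"

text \<open>
  The total recursive functions of one argument, with several arguments passed through the
  Cantor pairing function. Minimization is applied to regular functions only, so that every
  function is total; by Kleene's normal form theorem this yields all total computable functions.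
\<close>

inductive recursive_fun :: "(nat \<Rightarrow> nat) \<Rightarrow> bool" where
  rec_zero: "recursive_fun (\<lambda>_. 0)"
| rec_Suc: "recursive_fun Suc"
| rec_fst: "recursive_fun (\<lambda>x. fst (prod_decode x))"
| rec_snd: "recursive_fun (\<lambda>x. snd (prod_decode x))"
| rec_pair: "recursive_fun f \<Longrightarrow> recursive_fun g \<Longrightarrow> recursive_fun (\<lambda>x. prod_encode (f x, g x))"
| rec_comp: "recursive_fun f \<Longrightarrow> recursive_fun g \<Longrightarrow> recursive_fun (\<lambda>x. f (g x))"
| rec_prim: "recursive_fun f \<Longrightarrow> recursive_fun g \<Longrightarrow>
    recursive_fun (\<lambda>x. case prod_decode x of (a, n) \<Rightarrow>
      rec_nat (f a) (\<lambda>k y. g (prod_encode (a, prod_encode (k, y)))) n)"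
| rec_min: "recursive_fun f \<Longrightarrow> (\<And>a. \<exists>n. f (prod_encode (a, n)) = 0) \<Longrightarrow>
    recursive_fun (\<lambda>a. LEAST n. f (prod_encode (a, n)) = 0)"

text \<open>
  A polynomial is coded as a list of terms, each consisting of an exponent list and a coefficient.
  Decoding sums up the terms of an arbitrary list, in any order and possibly with repeated
  monomials, so it is not injective; it is a left inverse of the encoding
  (lemma \<open>decode_encode_mpoly\<close>).
\<close>

definition encode_monom :: "(nat \<Rightarrow>\<^sub>0 nat) \<Rightarrow> nat" where
  "encode_monom e = list_encode (map (Poly_Mapping.lookup e) [0..<Poly_Mapping.degree e])"

definition decode_monom :: "nat \<Rightarrow> (nat \<Rightarrow>\<^sub>0 nat)" where
  "decode_monom c = Poly_Mapping.nth (list_decode c)"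

definition encode_mpoly :: "int_mpoly \<Rightarrow> nat" where
  "encode_mpoly p = list_encode
     (map (\<lambda>c. prod_encode (c, int_encode (Poly_Mapping.lookup p (decode_monom c))))
        (sorted_list_of_set (encode_monom ` Poly_Mapping.keys p)))"

definition decode_mpoly :: "nat \<Rightarrow> int_mpoly" where
  "decode_mpoly c =
     (\<Sum>t\<leftarrow>list_decode c. case prod_decode t of
        (e, k) \<Rightarrow> Poly_Mapping.single (decode_monom e) (int_decode k))"

definition encode_input ::
  "int \<Rightarrow> nat \<Rightarrow> nat \<Rightarrow> nat \<Rightarrow> nat \<Rightarrow> int_mpoly list \<Rightarrow> int_mpoly list \<Rightarrow> nat" where
  "encode_input D r m s t Ps Rs = list_encode
     [int_encode D, r, m, s, t,
      list_encode (map encode_mpoly Ps), list_encode (map encode_mpoly Rs)]"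

lemma decode_encode_monom: "decode_monom (encode_monom e) = e"
  by (simp add: decode_monom_def encode_monom_def Poly_Mapping.nth_idem)

lemma decode_encode_mpoly: "decode_mpoly (encode_mpoly p) = p"
proof -
  have inj: "inj_on encode_monom (Poly_Mapping.keys p)"
    by (rule inj_on_inverseI) (rule decode_encode_monom)
  have "decode_mpoly (encode_mpoly p) =
      (\<Sum>c\<leftarrow>sorted_list_of_set (encode_monom ` Poly_Mapping.keys p).
         Poly_Mapping.single (decode_monom c) (Poly_Mapping.lookup p (decode_monom c)))"
    by (simp add: decode_mpoly_def encode_mpoly_def o_def)
  also have "\<dots> = (\<Sum>c\<in>encode_monom ` Poly_Mapping.keys p.
         Poly_Mapping.single (decode_monom c) (Poly_Mapping.lookup p (decode_monom c)))"
    by (subst sum_list_distinct_conv_sum_set) simp_all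
  also have "\<dots> = (\<Sum>e\<in>Poly_Mapping.keys p. Poly_Mapping.single e (Poly_Mapping.lookup p e))"
    by (simp add: sum.reindex[OF inj] decode_encode_monom)
  also have "\<dots> = p"
  proof (rule poly_mapping_eqI)
    fix k
    have "Poly_Mapping.lookup (\<Sum>e\<in>Poly_Mapping.keys p. Poly_Mapping.single e (Poly_Mapping.lookup p e)) k =
        (\<Sum>e\<in>Poly_Mapping.keys p. if e = k then Poly_Mapping.lookup p e else 0)"
      by (simp add: lookup_sum lookup_single when_def)
    then show "Poly_Mapping.lookup (\<Sum>e\<in>Poly_Mapping.keys p. Poly_Mapping.single e (Poly_Mapping.lookup p e)) k =
        Poly_Mapping.lookup p k"
      by (simp add: sum.delta in_keys_iff)
  qed
  finally show ?thesis .
qed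

lemma quadratic_number_field_eq_rat_adjoin_sqrt:
  assumes "quadratic_number_field K"
  shows "\<exists>D. squarefree D \<and> D \<noteq> 0 \<and> D \<noteq> 1 \<and> K = rat_adjoin_sqrt D"
proof -
  have K1: "1 \<in> K" and Kd: "\<And>x y. x \<in> K \<Longrightarrow> y \<in> K \<Longrightarrow> x - y \<in> K"
    and Km: "\<And>x y. x \<in> K \<Longrightarrow> y \<in> K \<Longrightarrow> x * y \<in> K" and Ki: "\<And>x. x \<in> K \<Longrightarrow> inverse x \<in> K"
    and dim: "rat_vs.dim K = 2"
    using assms by (auto simp: quadratic_number_field_def complex_subfield_def)
  have K0: "0 \<in> K" using Kd[OF K1 K1] by simp
  have Ka: "x + y \<in> K" if "x \<in> K" "y \<in> K" for x y
    using Kd[OF that(1) Kd[OF K0 that(2)]] by simp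
  have Knat: "of_nat n \<in> K" for n
    by (induction n) (auto simp: K0 K1 Ka)
  have Kint: "of_int n \<in> K" for n
    by (cases n rule: int_cases2) (use Knat Kd[OF K0 Knat] in auto)
  have Krat: "of_rat q \<in> K" for q
  proof (cases q)
    case (Fract a b)
    then have "of_rat q = of_int a * inverse (of_int b :: complex)"
      by (simp add: of_rat_rat field_simps)
    then show ?thesis using Km[OF Kint Ki[OF Kint]] by simp
  qed
  have sub: "rat_vs.subspace K"
    by (auto simp: rat_vs.subspace_def K0 Ka rat_scale_def Km Krat)
  have ind1: "rat_vs.independent {1}" by (simp add: rat_vs.independent_insert)
  have K1s: "{1} \<subseteq> K" using K1 by simp
  obtain B where B: "{1} \<subseteq> B" "B \<subseteq> K" "rat_vs.independent B" "K \<subseteq> rat_vs.span B"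
    using rat_vs.maximal_independent_subset_extend[OF K1s ind1] by blast
  have "card B = 2" using rat_vs.basis_card_eq_dim[OF B(2) B(4) B(3)] dim by simp
  then obtain w where w: "B = {1, w}" "w \<noteq> 1"
    using B(1) unfolding card_2_iff by auto
  have span: "x \<in> K \<longleftrightarrow> (\<exists>p q. x = of_rat p + of_rat q * w)" for x
  proof
    assume "x \<in> K"
    then have "x \<in> rat_vs.span {1, w}" using B(4) w by auto
    then obtain p where "x - rat_scale p 1 \<in> rat_vs.span {w}"
      using rat_vs.span_breakdown_eq[of x 1 "{w}"] by blast
    then obtain q where "x - rat_scale p 1 = rat_scale q w"
      using rat_vs.span_breakdown_eq[of "x - rat_scale p 1" w "{}"] by auto
    then show "\<exists>p q. x = of_rat p + of_rat q * w"
      by (intro exI[of _ p] exI[of _ q]) (simp add: rat_scale_def algebra_simps)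
  next
    assume "\<exists>p q. x = of_rat p + of_rat q * w"
    then show "x \<in> K" using Ka Km Krat B(2) w by auto
  qed
  have wK: "w \<in> K" using B(2) w by auto
  have wnr: "w \<noteq> of_rat p" for p
  proof
    assume "w = of_rat p"
    then have "w \<in> rat_vs.span {1}"
      using rat_vs.span_scale[OF rat_vs.span_base[of 1 "{1}"], of p]
      by (simp add: rat_scale_def)
    moreover have "rat_vs.independent (insert w {1})"
      using B(3) w by (simp add: insert_commute)
    ultimately show False using w(2) by (simp add: rat_vs.independent_insert)
  qed
  obtain p q where pq: "w * w = of_rat p + of_rat q * w"
    using span[of "w * w"] Km[OF wK wK] by auto
  define d where "d = p + q\<^sup>2 / 4"
  define \<delta> where "\<delta> = w - of_rat (q / 2)"
  have d2: "\<delta> * \<delta> = of_rat d"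
  proof -
    have "\<delta> * \<delta> = w * w - of_rat q * w + (of_rat q)\<^sup>2 / 4"
      by (simp add: \<delta>_def of_rat_divide field_simps power2_eq_square)
    then show ?thesis
      using pq by (simp add: d_def of_rat_add of_rat_divide of_rat_power)
  qed
  obtain a b where ab: "d = Fract a b" "b > 0" by (cases d) auto
  define n where "n = a * b"
  have n2: "(of_int b * \<delta>) * (of_int b * \<delta>) = of_int n"
  proof -
    have "(of_int b * \<delta>) * (of_int b * \<delta>) = of_int b * of_int b * (\<delta> * \<delta>)"
      by (simp add: mult_ac)
    also have "\<dots> = of_int b * of_int b * (of_int a / of_int b)"
      using d2 ab by (simp add: of_rat_rat)
    finally have "(of_int b * \<delta>) * (of_int b * \<delta>) = of_int b * of_int b * (of_int a / of_int b)" .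
    then show ?thesis using ab(2) by (simp add: n_def)
  qed
  have dnr: "\<delta> \<noteq> of_rat x" for x
  proof
    assume "\<delta> = of_rat x"
    then have "w = of_rat (x + q / 2)" by (simp add: \<delta>_def of_rat_add algebra_simps)
    then show False using wnr by blast
  qed
  have d0: "\<delta> \<noteq> 0" using dnr[of 0] by simp
  have n0: "n \<noteq> 0" using n2 d0 ab(2) by auto
  define D where "D = squarefree_part n"
  define k where "k = square_part n"
  have nDk: "n = D * k\<^sup>2" unfolding D_def k_def by (rule squarefree_decompose)
  have k0: "k \<noteq> 0" using n0 by (simp add: k_def)
  define c :: rat where "c = of_int b / of_int k"
  have c0: "c \<noteq> 0" using ab(2) k0 by (simp add: c_def)
  have cd: "(of_rat c * \<delta>)\<^sup>2 = of_int D"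
  proof -
    have "(of_rat c * \<delta>)\<^sup>2 = (of_int b * \<delta>) * (of_int b * \<delta>) / (of_int k)\<^sup>2"
      by (simp add: c_def of_rat_divide power2_eq_square)
    also have "\<dots> = of_int D" using nDk k0 by (simp only: n2) (simp add: field_simps)
    finally show ?thesis .
  qed
  then have "(of_rat c * \<delta>)\<^sup>2 = (csqrt (of_int D))\<^sup>2" by simp
  then have "csqrt (of_int D) = of_rat c * \<delta> \<or> csqrt (of_int D) = - (of_rat c * \<delta>)"
    unfolding power2_eq_iff by auto
  then obtain c' where c': "c' \<noteq> 0" "csqrt (of_int D) = of_rat c' * \<delta>"
    using c0 by (metis of_rat_minus minus_mult_left neg_equal_0_iff_equal)
  have "D \<noteq> 1"
  proof
    assume "D = 1"
    then have "\<delta> = of_rat (1 / c')" using c' by (simp add: of_rat_divide field_simps)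
    then show False using dnr by blast
  qed
  moreover have "squarefree D" unfolding D_def by simp
  moreover have "D \<noteq> 0" unfolding D_def by simp
  moreover have "K = rat_adjoin_sqrt D"
  proof (intro set_eqI iffI)
    fix x assume "x \<in> K"
    then obtain u v where x: "x = of_rat u + of_rat v * w" using span by auto
    have "x = of_rat (u + v * (q / 2)) + of_rat (v / c') * csqrt (of_int D)"
      unfolding x c'(2) using c'(1)
      by (simp add: \<delta>_def of_rat_add of_rat_mult of_rat_divide field_simps)
    then show "x \<in> rat_adjoin_sqrt D" unfolding rat_adjoin_sqrt_def by blast
  next
    fix x assume "x \<in> rat_adjoin_sqrt D"
    then obtain u v where x: "x = of_rat u + of_rat v * csqrt (of_int D)"
      by (auto simp: rat_adjoin_sqrt_def)
    have "\<delta> \<in> K" unfolding \<delta>_def using Kd wK Krat by blast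
    then show "x \<in> K" unfolding x c' by (intro Ka Km Krat)
  qed
  ultimately show ?thesis by blast
qed

end

theory Submission
  imports Defs "HOL-Analysis.Kronecker_Approximation_Theorem"
begin

text \<open>
  Let \<open>d = D\<close> if \<open>D > 0\<close> and \<open>d = 3\<close> otherwise. Then every solution of \<open>x\<^sup>2 - d y\<^sup>2 = 1\<close> in
  \<open>O_K\<close> with \<open>2 dvd y\<close> is rational: for \<open>D > 0\<close> because \<open>x + y sqrt D\<close> is a unit of \<open>K\<close> itself, and for
  \<open>D < 0\<close> because \<open>K(sqrt d)\<close> has no more units, up to torsion, than its real subfield.

  Put \<open>y = 2 N f u\<close>, where \<open>N\<close> is the product of the \<open>R_j\<close> and \<open>f\<close> that of all \<open>1 + 2 z\<^sup>2\<close> for \<open>z\<close> among the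
  \<open>X_i, Y_i\<close>. If \<open>d y\<^sup>2 + 1\<close> is a square and \<open>y \<noteq> 0\<close>, then \<open>y\<close> is a rational integer exceeding (up to the
  factor 2) the irrational part of every \<open>z\<close>. Doubling the index of the Pell solution repeatedly yields a
  rational integer \<open>a = 1 + 2 y\<^sup>2 p\<close>, \<open>p\<close> a polynomial in \<open>y\<close> as large as we like, such that \<open>a\<^sup>2 - 1\<close> is \<open>d\<close> times
  a square. If moreover \<open>(a\<^sup>2 - 1) V\<^sup>2 + 1\<close> is a square for \<open>V = s + k y p\<close>, where \<open>s\<close> has the \<open>z\<close> as digits in
  base \<open>4 y\<^sup>2\<close>, then \<open>V\<close> is rational as well, hence \<open>y p\<close> divides the irrational part of \<open>s\<close>, which
  is too small for this unless it vanishes; so all \<open>z\<close> are rational. Conversely, rational \<open>z\<close> admit such \<open>k\<close>,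
  with any prescribed residue modulo \<open>y\<close>, because the Pell solutions satisfy \<open>V_m \<equiv> m\<close> modulo \<open>a - 1\<close>.

  The condition \<open>y \<noteq> 0\<close> is forced by requiring \<open>y dvd (2 k - 1) (3 k - 1)\<close>, a number without zeros in \<open>O_K\<close>
  but with zeros modulo every nonzero integer. The two square conditions and the divisibility are expressed by one
  unknown \<open>j\<close>: \<open>y j = (2 k - 1) (3 k - 1) \<plusminus> y sqrt A1 \<plusminus> 2 y sqrt A2\<close>. Finally, equations are combined by
  \<open>A\<^sup>2 - c B\<^sup>2 = 0\<close> for a nonsquare \<open>c\<close> of \<open>K\<close>.
\<close>

section \<open>The Pell equation in coordinates\<close>

text \<open>For negative \<open>D\<close> the signs decide. Otherwise some prime divides
  \<open>D\<close> exactly once; for nonzero \<open>y\<close> its multiplicity would be even in x^2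
  and odd in D y^2.\<close>

lemma squarefree_mult_square_eq_square:
  fixes D x y :: int
  assumes "squarefree D" "D \<noteq> 0" "D \<noteq> 1" "x\<^sup>2 = D * y\<^sup>2"
  shows "x = 0 \<and> y = 0"
proof (cases "D < 0")
  case True
  then have "D * y\<^sup>2 \<le> 0" by (simp add: mult_nonpos_nonneg)
  with assms(4) have "x = 0" by (smt (verit) zero_le_power2 power2_eq_iff zero_power2)
  with assms show ?thesis by auto
next
  case False
  with assms have "D > 1" by linarith
  then obtain p where p: "prime p" "p dvd D" using prime_factor_int[of D] by auto
  have mD: "multiplicity p D = 1"
    using squarefree_factorial_semiring'[of D] assms p
    by (metis in_prime_factors_iff)
  have "y = 0"
  proof (rule ccontr)
    assume y: "y \<noteq> 0"
    then have x: "x \<noteq> 0" using assms by auto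
    have "2 * multiplicity p x = multiplicity p (x\<^sup>2)"
      by (rule prime_elem_multiplicity_power_distrib[symmetric]) (use p x in auto)
    also have "\<dots> = multiplicity p D + 2 * multiplicity p y"
      unfolding assms(4) using p y assms(2)
      by (subst prime_elem_multiplicity_mult_distrib)
        (auto intro!: prime_elem_multiplicity_power_distrib)
    finally show False using mD by presburger
  qed
  with assms show ?thesis by simp
qed

text \<open>The two equations are the coordinates of (p + q sqrt D)^2 = 1 + d (r + s sqrt D)^2. The
  quantities \<open>A\<close> and \<open>B\<close> satisfy A + D B = 1 and A B = - d (p s - q r)^2,
  which leaves few possibilities for them.\<close>

lemma pell_coordinates:
  fixes p q r s d D :: int
  assumes D: "squarefree D" "D \<noteq> 0" "D \<noteq> 1" "d = (if D > 0 then D else 3)"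
    and pq: "p * q = d * r * s" and eq: "p\<^sup>2 + D * q\<^sup>2 = 1 + d * (r\<^sup>2 + D * s\<^sup>2)"
  shows "q = 0 \<and> s = 0"
proof -
  define A where "A = p\<^sup>2 - d * r\<^sup>2"
  define B where "B = q\<^sup>2 - d * s\<^sup>2"
  have AB1: "A + D * B = 1" using eq unfolding A_def B_def by (simp add: algebra_simps)
  have "A * B = (p * q)\<^sup>2 + d\<^sup>2 * (r * s)\<^sup>2 - d * (p\<^sup>2 * s\<^sup>2 + q\<^sup>2 * r\<^sup>2)"
    unfolding A_def B_def by (simp add: algebra_simps power2_eq_square)
  also have "\<dots> = 2 * d * (p * q) * (r * s) - d * (p\<^sup>2 * s\<^sup>2 + q\<^sup>2 * r\<^sup>2)"
    unfolding pq by (simp add: algebra_simps power2_eq_square)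
  finally have AB: "A * B = - d * (p * s - q * r)\<^sup>2"
    by (simp add: algebra_simps power2_eq_square)
  have d: "squarefree d" "d \<noteq> 0" "d \<noteq> 1"
    using D squarefree_prime[of "3::int"] by (auto split: if_splits)
  have B0: ?thesis if "B = 0"
    using squarefree_mult_square_eq_square[OF d, of q s] that unfolding B_def by simp
  show ?thesis
  proof (cases "D > 0")
    case True
    with D have dD: "d = D" "D \<ge> 2" by auto
    define C where "C = D * (p * s - q * r)"
    have "A * (D * B) = - C\<^sup>2" 
    proof -
      have "A * (D * B) = D * (A * B)" by simp
      also have "\<dots> = - C\<^sup>2" unfolding AB C_def using dD by (simp add: power2_eq_square)
      finally show ?thesis .
    qed
    moreover have "D * B = 1 - A" using AB1 by simp
    ultimately have "A * (1 - A) = - C\<^sup>2" by simp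
    \<comment> \<open>The product of two consecutive integers is a square only if one of them is
      0.\<close>
    then have "A * (A - 1) = C\<^sup>2" by (simp add: algebra_simps)
    then have sq: "(2 * A - 1)\<^sup>2 - (2 * C)\<^sup>2 = 1" by (simp add: power2_eq_square algebra_simps)
    then have "(2 * A - 1 - 2 * C) * (2 * A - 1 + 2 * C) = 1" by (simp add: power2_eq_square algebra_simps)
    then have "A = 0 \<or> A = 1" by (auto simp: zmult_eq_1_iff)
    then show ?thesis
    proof
      assume "A = 1"
      then have "B = 0" using AB1 D by simp
      then show ?thesis by (rule B0)
    next
      assume "A = 0"
      then have "D * B = 1" using AB1 by simp
      then show ?thesis using dD by (auto simp: zmult_eq_1_iff)
    qed
  next
    case False
    with D have d3: "d = 3" and Dneg: "D < 0" by auto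
    have le: "A * B \<le> 0" using AB d3 by simp
    consider "B = 0" | "B \<ge> 1" | "B \<le> -1" by linarith
    then show ?thesis
    proof cases
      case 2
      have "D * B < 0" using 2 Dneg by (simp add: mult_neg_pos)
      then have "A * B > 0" using AB1 2 by simp
      then show ?thesis using le by simp
    next
      case 3
      have DB: "D * B \<ge> 1" using 3 Dneg by (smt (verit) mult_neg_neg)
      have "A \<ge> 0"
      proof (rule ccontr)
        assume "\<not> A \<ge> 0"
        then have "A * B > 0" using 3 by (simp add: mult_neg_neg)
        then show False using le by simp
      qed
      then have "D * B = 1" using AB1 DB by simp
      then have "B = -1" using Dneg by (auto simp: zmult_eq_1_iff)
      \<comment> \<open>What remains is q^2 - 3 s^2 = -1, which is impossible modulo 3; hence the
        value 3 for \<open>d\<close>.\<close>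
      then have "q\<^sup>2 mod 3 = 2"
        unfolding B_def d3 by presburger
      moreover have "q\<^sup>2 mod 3 = (q mod 3)\<^sup>2 mod 3" by (simp add: power_mod)
      moreover have "q mod 3 = 0 \<or> q mod 3 = 1 \<or> q mod 3 = 2" by presburger
      ultimately show ?thesis by auto
    qed (rule B0)
  qed
qed

lemma square_mod_4_int: "(p::int)\<^sup>2 mod 4 = (if even p then 0 else 1)"
proof (cases "even p")
  case True
  then obtain k where "p = 2 * k" by (elim evenE)
  then have "p\<^sup>2 = 4 * k\<^sup>2" by (simp add: power2_eq_square)
  with True show ?thesis by simp
next
  case False
  then obtain k where "p = 2 * k + 1" by (elim oddE)
  then have "p\<^sup>2 = 1 + 4 * (k\<^sup>2 + k)" by (simp add: power2_eq_square algebra_simps)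
  then have "p\<^sup>2 mod 4 = 1" by presburger
  with False show ?thesis by simp
qed

text \<open>Squares are 0 or 1 modulo 4, and 4 does not divide \<open>D\<close>. This is the
  classical distinction between the rings Z[sqrt D] and Z[(1 + sqrt D) / 2].\<close>

lemma squarefree_norm_parity:
  fixes D p t :: int
  assumes "squarefree D" "4 dvd p\<^sup>2 - D * t\<^sup>2"
  shows "D mod 4 = 1 \<and> (even p \<longleftrightarrow> even t) \<or> even p \<and> even t"
proof -
  have D4: "\<not> 4 dvd D" using assms(1) squarefreeD[of D 2] by auto
  have "(p\<^sup>2 - D * t\<^sup>2) mod 4 = 0" using assms by auto
  then have "(p\<^sup>2 mod 4 - (D mod 4) * (t\<^sup>2 mod 4)) mod 4 = 0"
    by (subst mod_diff_cong[OF mod_mod_trivial mod_mult_cong[OF mod_mod_trivial mod_mod_trivial]]) simp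
  moreover have "D mod 4 = 1 \<or> D mod 4 = 2 \<or> D mod 4 = 3" using D4 by presburger
  ultimately show ?thesis
    unfolding square_mod_4_int by (auto split: if_splits)
qed

section \<open>Coordinates of quadratic integers\<close>

lemma squarefree_neq_rat_square:
  fixes x :: rat
  assumes D: "squarefree D" "D \<noteq> 0" "D \<noteq> 1"
  shows "x\<^sup>2 \<noteq> of_int D"
proof
  assume x: "x\<^sup>2 = of_int D"
  obtain a b where ab: "x = Fract a b" "b > 0" by (cases x) auto
  then have "x = of_int a / of_int b" by (simp add: Fract_of_int_quotient)
  with x ab have "of_int (a\<^sup>2) = (of_int (D * b\<^sup>2) :: rat)"
    by (simp add: field_simps)
  then have "a\<^sup>2 = D * b\<^sup>2" by (simp only: of_int_eq_iff)
  then have "b = 0" using squarefree_mult_square_eq_square[OF D] by blast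
  with ab show False by simp
qed

locale quadratic_field =
  fixes D :: int and K :: "complex set"
  assumes squarefree_D: "squarefree D" and D_nonzero: "D \<noteq> 0" and D_not_1: "D \<noteq> 1"
    and K_eq: "K = rat_adjoin_sqrt D" and K_field: "complex_subfield K"
begin

abbreviation \<rho> :: complex where "\<rho> \<equiv> csqrt (of_int D)"
abbreviation OK :: "complex set" where "OK \<equiv> ring_of_integers K"

lemma rho_square: "\<rho>\<^sup>2 = of_int D"
  by simp

lemma rho_mult: "\<rho> * \<rho> = of_int D"
  using rho_square by (simp add: power2_eq_square)

lemma K_one: "1 \<in> K" and K_diff: "x \<in> K \<Longrightarrow> y \<in> K \<Longrightarrow> x - y \<in> K"
  and K_mult: "x \<in> K \<Longrightarrow> y \<in> K \<Longrightarrow> x * y \<in> K" and K_inverse: "x \<in> K \<Longrightarrow> inverse x \<in> K"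
  using K_field by (auto simp: complex_subfield_def)

lemma K_add: "x \<in> K \<Longrightarrow> y \<in> K \<Longrightarrow> x + y \<in> K"
  using K_diff[of x "0 - y"] K_diff[of 0 y] K_diff[of 1 1] K_one by simp

lemma K_divide: "x \<in> K \<Longrightarrow> y \<in> K \<Longrightarrow> x / y \<in> K"
  by (simp add: divide_inverse K_mult K_inverse)

lemma K_coordinates: "x \<in> K \<longleftrightarrow> (\<exists>p q. x = of_rat p + of_rat q * \<rho>)"
  by (auto simp: K_eq rat_adjoin_sqrt_def)

lemma independent:
  assumes "of_rat p + of_rat q * \<rho> = of_rat p' + of_rat q' * \<rho>"
  shows "p = p' \<and> q = q'"
proof -
  have q: "q = q'"
  proof (rule ccontr)
    assume nz: "q \<noteq> q'"
    have "of_rat (q - q') * \<rho> = of_rat (p' - p)"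
      using assms by (simp add: of_rat_diff algebra_simps)
    then have "(of_rat (q - q'))\<^sup>2 * \<rho>\<^sup>2 = (of_rat (p' - p))\<^sup>2"
      by (metis power_mult_distrib)
    then have "of_rat ((q - q')\<^sup>2 * of_int D) = (of_rat ((p' - p)\<^sup>2) :: complex)"
      by (simp add: of_rat_mult of_rat_power)
    then have "(q - q')\<^sup>2 * of_int D = (p' - p)\<^sup>2" by (simp only: of_rat_eq_iff)
    then have "((p' - p) / (q - q'))\<^sup>2 = of_int D" using nz by (simp add: field_simps)
    then show False using squarefree_neq_rat_square[OF squarefree_D D_nonzero D_not_1] by blast
  qed
  with assms show ?thesis by simp
qed

lemma independent_int:
  assumes "of_int p + of_int q * \<rho> = of_int p' + of_int q' * \<rho>"
  shows "p = p' \<and> q = q'"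
  using independent[of "of_int p" "of_int q" "of_int p'" "of_int q'"] assms by simp

section \<open>Integral elements of K and their coordinates\<close>

lemma rat_powers_bounded_denominator_int:
  fixes x :: rat and M :: int
  assumes M: "M \<noteq> 0" and int: "\<And>k. of_int M * x ^ k \<in> \<int>"
  shows "x \<in> \<int>"
proof -
  obtain a b where ab: "x = Fract a b" "b > 0" "coprime a b" by (cases x) auto
  have "b = 1"
  proof (rule ccontr)
    assume "b \<noteq> 1"
    with ab have b2: "b \<ge> 2" by simp
    \<comment> \<open>The reduced denominator \<open>b\<close> satisfies that \<open>b ^ k\<close>
      divides \<open>M\<close> for every exponent; since 2^k > k, the exponent |M| already
      contradicts this.\<close>
    define k where "k = nat \<bar>M\<bar>"
    obtain c where "of_int M * x ^ k = of_int c" using int by (auto elim: Ints_cases)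
    then have "of_int (M * a ^ k) = (of_int (c * b ^ k) :: rat)"
      using ab by (simp add: Fract_of_int_quotient field_simps)
    then have "M * a ^ k = c * b ^ k" by (simp only: of_int_eq_iff)
    then have "b ^ k dvd M * a ^ k" by simp
    then have "b ^ k dvd M" using ab(3)
      by (metis coprime_commute coprime_dvd_mult_left_iff coprime_power_left_iff coprime_power_right_iff)
    then have "b ^ k \<le> \<bar>M\<bar>" using M by (metis abs_of_nonneg dvd_imp_le_int zero_le_power abs_ge_zero ab(2) less_imp_le)
    moreover have "int k < 2 ^ k" by (metis of_nat_less_two_power)
    moreover have "2 ^ k \<le> b ^ k" using b2 by (intro power_mono) auto
    ultimately show False by (simp add: k_def)
  qed
  with ab show ?thesis by (simp add: Fract_of_int_quotient)
qed

text \<open>The order Z[\<rho>], possibly of index 2 in \<open>OK\<close>; denominators are measured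
  against this lattice.\<close>

definition Z_rho :: "complex set" where "Z_rho = {of_int a + of_int b * \<rho> | a b. True}"

lemma Z_rho_add: "x \<in> Z_rho \<Longrightarrow> y \<in> Z_rho \<Longrightarrow> x + y \<in> Z_rho"
proof -
  assume "x \<in> Z_rho" "y \<in> Z_rho"
  then obtain a b a' b' where "x = of_int a + of_int b * \<rho>" "y = of_int a' + of_int b' * \<rho>"
    by (auto simp: Z_rho_def)
  then have "x + y = of_int (a + a') + of_int (b + b') * \<rho>" by (simp add: algebra_simps)
  then show ?thesis unfolding Z_rho_def by blast
qed

lemma Z_rho_mult: "x \<in> Z_rho \<Longrightarrow> y \<in> Z_rho \<Longrightarrow> x * y \<in> Z_rho"
proof -
  assume "x \<in> Z_rho" "y \<in> Z_rho"
  then obtain a b a' b' where "x = of_int a + of_int b * \<rho>" "y = of_int a' + of_int b' * \<rho>"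
    by (auto simp: Z_rho_def)
  then have "x * y = of_int (a * a' + b * b' * D) + of_int (a * b' + b * a') * \<rho>"
    by (simp add: algebra_simps rho_mult)
  then show ?thesis unfolding Z_rho_def by blast
qed

lemma Z_rho_int: "of_int a \<in> Z_rho"
  unfolding Z_rho_def by (rule CollectI, rule exI[of _ a], rule exI[of _ 0]) simp

lemma Z_rho_sum: "(\<And>i. i \<in> A \<Longrightarrow> f i \<in> Z_rho) \<Longrightarrow> sum f A \<in> Z_rho"
  using Z_rho_int[of 0] by (induction A rule: infinite_finite_induct) (auto intro: Z_rho_add)

lemma Z_rho_power: "x \<in> Z_rho \<Longrightarrow> x ^ n \<in> Z_rho"
  using Z_rho_int[of 1] by (induction n) (auto intro: Z_rho_mult)

text \<open>Let \<open>c\<close> clear the denominators of \<open>x\<close> and let \<open>m\<close>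
  be the degree of a monic integral equation for \<open>x\<close>. Then \<open>c ^ m\<close> works:
  directly for exponents below \<open>m\<close>, and through the equation for the higher
  ones.\<close>

lemma powers_bounded_denominator:
  assumes "x \<in> K" "algebraic_int x"
  shows "\<exists>M\<noteq>0. \<forall>k. of_int M * x ^ k \<in> Z_rho"
proof -
  obtain p q where x: "x = of_rat p + of_rat q * \<rho>" using assms K_coordinates by auto
  obtain a b where ab: "p = Fract a b" "b > 0" by (cases p) auto
  obtain a' b' where ab': "q = Fract a' b'" "b' > 0" by (cases q) auto
  define c where "c = b * b'"
  have c: "c \<noteq> 0" using ab ab' by (simp add: c_def)
  have "of_int c * x = of_int (a * b') + of_int (a' * b) * \<rho>"
    using ab ab' by (simp add: x c_def of_rat_rat field_simps)
  then have cx: "of_int c * x \<in> Z_rho" unfolding Z_rho_def by blast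
  obtain P where P: "\<And>i. coeff P i \<in> \<int>" "lead_coeff P = 1" "poly P x = 0"
    using assms(2) by (meson algebraic_int.cases)
  define m where "m = degree P"
  have P0: "x ^ m = - (\<Sum>i<m. coeff P i * x ^ i)"
  proof -
    have "0 = (\<Sum>i\<le>m. coeff P i * x ^ i)" using P(3) by (simp add: poly_altdef m_def)
    also have "\<dots> = (\<Sum>i<m. coeff P i * x ^ i) + x ^ m"
      using P(2) by (simp add: m_def flip: lessThan_Suc_atMost)
    finally show ?thesis by (simp add: eq_neg_iff_add_eq_0 add.commute)
  qed
  have "of_int (c ^ m) * x ^ k \<in> Z_rho" for k
  proof (induction k rule: less_induct)
    case (less k)
    show ?case
    proof (cases "k < m")
      case True
      have "of_int (c ^ m) * x ^ k = of_int (c ^ (m - k)) * (of_int c * x) ^ k"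
        using True by (simp add: power_mult_distrib flip: power_add)
      then show ?thesis using cx Z_rho_int[of "c ^ (m - k)"] by (simp add: Z_rho_mult Z_rho_power)
    next
      case False
      then have "x ^ k = x ^ (k - m) * x ^ m" by (simp flip: power_add)
      also have "\<dots> = (\<Sum>i<m. - coeff P i * x ^ (k - m + i))"
        by (simp add: P0 sum_distrib_left power_add mult_ac sum_negf)
      finally have "of_int (c ^ m) * x ^ k = (\<Sum>i<m. - coeff P i * (of_int (c ^ m) * x ^ (k - m + i)))"
        by (simp add: sum_distrib_left mult_ac)
      moreover have "- coeff P i * (of_int (c ^ m) * x ^ (k - m + i)) \<in> Z_rho" if "i < m" for i
      proof (rule Z_rho_mult)
        show "- coeff P i \<in> Z_rho" using P(1)[of i] Z_rho_int by (metis Ints_cases Ints_minus)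
        show "of_int (c ^ m) * x ^ (k - m + i) \<in> Z_rho" using False that by (intro less) auto
      qed
      ultimately show ?thesis by (simp only:) (rule Z_rho_sum, simp)
    qed
  qed
  with c show ?thesis by (metis power_eq_0_iff)
qed

text \<open>By multiplicativity, \<open>M\<^sup>2\<close> times any power of the norm of
  \<open>x\<close> is the norm of an element of \<open>Z_rho\<close>, hence an integer.\<close>

lemma norm_int_of_bounded_denominator:
  assumes x: "x = of_rat p + of_rat q * \<rho>" and M: "M \<noteq> 0" "\<And>k. of_int M * x ^ k \<in> Z_rho"
  shows "p\<^sup>2 - of_int D * q\<^sup>2 \<in> \<int>"
proof (rule rat_powers_bounded_denominator_int)
  show "M\<^sup>2 \<noteq> 0" using M by simp
  fix k
  have "\<exists>P Q. x ^ k = of_rat P + of_rat Q * \<rho> \<and> P\<^sup>2 - of_int D * Q\<^sup>2 = (p\<^sup>2 - of_int D * q\<^sup>2) ^ k"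
  proof (induction k)
    case 0
    then show ?case by (intro exI[of _ 1] exI[of _ 0]) auto
  next
    case (Suc k)
    then obtain P Q where PQ: "x ^ k = of_rat P + of_rat Q * \<rho>"
      "P\<^sup>2 - of_int D * Q\<^sup>2 = (p\<^sup>2 - of_int D * q\<^sup>2) ^ k" by blast
    have "x ^ Suc k = of_rat (p * P + q * Q * of_int D) + of_rat (p * Q + q * P) * \<rho>"
    proof -
      have "x ^ Suc k = (of_rat p + of_rat q * \<rho>) * (of_rat P + of_rat Q * \<rho>)"
        using PQ(1) x by simp
      also have "\<dots> = of_rat p * of_rat P + of_rat q * of_rat Q * (\<rho> * \<rho>)
          + (of_rat p * of_rat Q + of_rat q * of_rat P) * \<rho>"
        by (simp add: algebra_simps)
      finally show ?thesis by (simp add: rho_mult of_rat_add of_rat_mult)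
    qed
    moreover have "(p * P + q * Q * of_int D)\<^sup>2 - of_int D * (p * Q + q * P)\<^sup>2 =
        (p\<^sup>2 - of_int D * q\<^sup>2) * (P\<^sup>2 - of_int D * Q\<^sup>2)"
      by (simp add: power2_eq_square algebra_simps)
    ultimately show ?case using PQ(2) by (metis power_Suc)
  qed
  then obtain P Q where PQ: "x ^ k = of_rat P + of_rat Q * \<rho>"
    "P\<^sup>2 - of_int D * Q\<^sup>2 = (p\<^sup>2 - of_int D * q\<^sup>2) ^ k" by blast
  obtain a b where ab: "of_int M * x ^ k = of_int a + of_int b * \<rho>"
    using M(2)[of k] by (auto simp: Z_rho_def)
  then have "of_rat (of_int M * P) + of_rat (of_int M * Q) * \<rho> = of_rat (of_int a) + of_rat (of_int b) * \<rho>"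
    by (simp add: PQ of_rat_mult algebra_simps)
  then have "of_int M * P = of_int a" "of_int M * Q = of_int b"
    using independent by blast+
  then have "of_int (M\<^sup>2) * (p\<^sup>2 - of_int D * q\<^sup>2) ^ k = of_int (a\<^sup>2 - D * b\<^sup>2)"
    unfolding PQ(2)[symmetric] by (simp add: power2_eq_square algebra_simps)
      (metis (no_types, lifting) mult.assoc mult.left_commute)
  then show "of_int (M\<^sup>2) * (p\<^sup>2 - of_int D * q\<^sup>2) ^ k \<in> \<int>" by (metis Ints_of_int)
qed

text \<open>The norms of \<open>x\<close> and \<open>x + 1\<close> are integers and differ by the
  trace plus 1, so the trace is an integer too. Conversely, \<open>x\<close> is a root of the monic
  quadratic polynomial formed from trace and norm.\<close>

lemma OK_iff: "x \<in> OK \<longleftrightarrow> (\<exists>p t. 2 * x = of_int p + of_int t * \<rho> \<and> 4 dvd p\<^sup>2 - D * t\<^sup>2)"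
proof
  assume "x \<in> OK"
  then have xK: "x \<in> K" "algebraic_int x" by (auto simp: ring_of_integers_def)
  then obtain p q where x: "x = of_rat p + of_rat q * \<rho>" using K_coordinates by auto
  obtain M where M: "M \<noteq> 0" "\<And>k. of_int M * x ^ k \<in> Z_rho"
    using powers_bounded_denominator xK by blast
  have N: "p\<^sup>2 - of_int D * q\<^sup>2 \<in> \<int>" by (rule norm_int_of_bounded_denominator[OF x M])
  \<comment> \<open>By the binomial theorem the same \<open>M\<close> serves for
    \<open>x + 1\<close>.\<close>
  have M1: "of_int M * (x + 1) ^ k \<in> Z_rho" for k
  proof -
    have "of_int M * (x + 1) ^ k = (\<Sum>i\<le>k. of_int (int (k choose i)) * (of_int M * x ^ i))"
      by (simp add: binomial_ring sum_distrib_left mult_ac)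
    then show ?thesis using M(2) Z_rho_int by (metis (no_types, lifting) Z_rho_sum Z_rho_mult)
  qed
  have "x + 1 = of_rat (p + 1) + of_rat q * \<rho>" by (simp add: x of_rat_add)
  then have "(p + 1)\<^sup>2 - of_int D * q\<^sup>2 \<in> \<int>"
    using norm_int_of_bounded_denominator M(1) M1 by blast
  then have "(p + 1)\<^sup>2 - of_int D * q\<^sup>2 - (p\<^sup>2 - of_int D * q\<^sup>2) - 1 \<in> \<int>"
    using N Ints_1 by (rule Ints_diff[OF Ints_diff])
  then have "2 * p \<in> \<int>" by (simp add: power2_eq_square algebra_simps)
  then obtain P where P: "2 * p = of_int P" by (auto elim: Ints_cases)
  obtain n where n: "p\<^sup>2 - of_int D * q\<^sup>2 = of_int n" using N by (auto elim: Ints_cases)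
  have eq: "of_int D * (2 * q)\<^sup>2 = of_int (P\<^sup>2 - 4 * n)"
    by (simp add: P[symmetric] n[symmetric] power2_eq_square algebra_simps)
  \<comment> \<open>A squarefree \<open>D\<close> cannot cancel the square of a denominator.\<close>
  have "2 * q \<in> \<int>"
  proof -
    obtain a b where ab: "2 * q = Fract a b" "b > 0" "coprime a b" by (cases "2 * q") auto
    then have "2 * q = of_int a / of_int b" by (simp add: Fract_of_int_quotient)
    then have "of_int D * (of_int a / of_int b)\<^sup>2 = (of_int (P\<^sup>2 - 4 * n) :: rat)"
      using eq by simp
    then have "of_int D * (of_int a)\<^sup>2 = (of_int (P\<^sup>2 - 4 * n) * (of_int b)\<^sup>2 :: rat)"
      using ab(2) by (simp only: power_divide times_divide_eq_right) (simp add: divide_eq_eq)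
    then have "of_int (D * a\<^sup>2) = (of_int ((P\<^sup>2 - 4 * n) * b\<^sup>2) :: rat)" by simp
    then have "D * a\<^sup>2 = (P\<^sup>2 - 4 * n) * b\<^sup>2" by (simp only: of_int_eq_iff)
    then have "b\<^sup>2 dvd D * a\<^sup>2" by simp
    then have "b\<^sup>2 dvd D" using ab(3)
      by (metis coprime_commute coprime_dvd_mult_left_iff coprime_power_left_iff coprime_power_right_iff)
    then have "is_unit b" using squarefree_D by (rule squarefreeD[rotated])
    with ab show ?thesis by (simp add: Fract_of_int_quotient)
  qed
  then obtain t where t: "2 * q = of_int t" by (auto elim: Ints_cases)
  have "of_int (P\<^sup>2 - D * t\<^sup>2) = (of_int (4 * n) :: rat)"
    using eq t by simp
  then have "P\<^sup>2 - D * t\<^sup>2 = 4 * n" by (simp only: of_int_eq_iff)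
  moreover have "2 * x = of_rat (2 * p) + of_rat (2 * q) * \<rho>"
    by (simp add: x of_rat_mult algebra_simps)
  then have "2 * x = of_int P + of_int t * \<rho>" by (simp add: P t)
  ultimately show "\<exists>p t. 2 * x = of_int p + of_int t * \<rho> \<and> 4 dvd p\<^sup>2 - D * t\<^sup>2"
    by (metis dvd_triv_left)
next
  assume "\<exists>p t. 2 * x = of_int p + of_int t * \<rho> \<and> 4 dvd p\<^sup>2 - D * t\<^sup>2"
  then obtain p t n where pt: "2 * x = of_int p + of_int t * \<rho>" "p\<^sup>2 - D * t\<^sup>2 = 4 * n" by auto
  have "x = of_rat (of_int p / 2) + of_rat (of_int t / 2) * \<rho>"
    using pt(1) by (simp add: of_rat_divide field_simps)
  then have "x \<in> K" using K_coordinates by blast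
  moreover have "algebraic_int x"
  proof
    show "lead_coeff [:of_int n, - of_int p, 1:] = (1::complex)" by simp
    show "\<forall>i. coeff [:of_int n, - of_int p, 1:] i \<in> (\<int> :: complex set)"
      by (auto simp: coeff_pCons split: nat.splits)
    have "4 * poly [:of_int n, - of_int p, 1:] x = of_int (4 * n) - 2 * of_int p * (2 * x) + (2 * x)\<^sup>2"
      by (simp add: algebra_simps power2_eq_square)
    also have "\<dots> = 0" unfolding pt(1) pt(2)[symmetric]
      by (simp add: algebra_simps power2_eq_square rho_mult)
    finally show "poly [:of_int n, - of_int p, 1:] x = 0"
      by (simp only: mult_eq_0_iff) simp
  qed
  ultimately show "x \<in> OK" by (simp add: ring_of_integers_def)
qed

section \<open>Ring operations and square roots in the ring of integers\<close>

lemma OK_in_K: "x \<in> OK \<Longrightarrow> x \<in> K"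
  by (simp add: ring_of_integers_def)

lemma OK_of_int [simp]: "of_int a \<in> OK"
  unfolding OK_iff by (rule exI[of _ "2 * a"], rule exI[of _ 0]) simp

lemma OK_numeral [simp]: "numeral k \<in> OK" "1 \<in> OK" "0 \<in> OK"
  using OK_of_int[of "numeral k"] OK_of_int[of 1] OK_of_int[of 0] by simp_all

text \<open>These are the coordinates of (2 x) (2 y); being even, they can be halved to give those
  of 2 x y.\<close>

lemma OK_parity:
  assumes "4 dvd p\<^sup>2 - D * t\<^sup>2" "4 dvd p'\<^sup>2 - D * t'\<^sup>2"
  shows "even (p * p' + D * t * t')" "even (p * t' + t * p')"
proof -
  have "D mod 4 = 1 \<Longrightarrow> odd D" by presburger
  then show "even (p * p' + D * t * t')" "even (p * t' + t * p')"
    using assms[THEN squarefree_norm_parity[OF squarefree_D]] by auto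
qed

lemma OK_mult: assumes "x \<in> OK" "y \<in> OK" shows "x * y \<in> OK"
proof -
  obtain p t n where x: "2 * x = of_int p + of_int t * \<rho>" "p\<^sup>2 - D * t\<^sup>2 = 4 * n"
    using assms(1) unfolding OK_iff by auto
  obtain p' t' n' where y: "2 * y = of_int p' + of_int t' * \<rho>" "p'\<^sup>2 - D * t'\<^sup>2 = 4 * n'"
    using assms(2) unfolding OK_iff by auto
  obtain P where P: "p * p' + D * t * t' = 2 * P" using OK_parity x(2) y(2) by (metis dvd_triv_left evenE)
  obtain T where T: "p * t' + t * p' = 2 * T" using OK_parity x(2) y(2) by (metis dvd_triv_left evenE)
  have "2 * (2 * (x * y)) = (2 * x) * (2 * y)" by simp
  also have "\<dots> = of_int (p * p' + D * t * t') + of_int (p * t' + t * p') * \<rho>"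
    unfolding x y by (simp add: algebra_simps rho_mult)
  also have "\<dots> = 2 * (of_int P + of_int T * \<rho>)" unfolding P T by (simp add: algebra_simps)
  finally have "2 * (x * y) = of_int P + of_int T * \<rho>"
    by (simp only: mult_left_cancel[OF zero_neq_numeral[symmetric]])
  moreover have "4 * (P\<^sup>2 - D * T\<^sup>2) = (2 * P)\<^sup>2 - D * (2 * T)\<^sup>2" by (simp add: algebra_simps power2_eq_square)
  then have "4 * (P\<^sup>2 - D * T\<^sup>2) = (p\<^sup>2 - D * t\<^sup>2) * (p'\<^sup>2 - D * t'\<^sup>2)"
    unfolding P[symmetric] T[symmetric] by (simp add: algebra_simps power2_eq_square)
  then have "P\<^sup>2 - D * T\<^sup>2 = 4 * (n * n')" unfolding x y by simp
  ultimately show ?thesis unfolding OK_iff by (metis dvd_triv_left)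
qed

lemma OK_add: assumes "x \<in> OK" "y \<in> OK" shows "x + y \<in> OK"
proof -
  obtain p t n where x: "2 * x = of_int p + of_int t * \<rho>" "p\<^sup>2 - D * t\<^sup>2 = 4 * n"
    using assms(1) unfolding OK_iff by auto
  obtain p' t' n' where y: "2 * y = of_int p' + of_int t' * \<rho>" "p'\<^sup>2 - D * t'\<^sup>2 = 4 * n'"
    using assms(2) unfolding OK_iff by auto
  \<comment> \<open>The norm of a sum contains the cross term 2 (p p' - D t t'), which has to be
    divisible by 4.\<close>
  have "even (p * p' + D * t * t' - 2 * (D * t * t'))" using OK_parity(1) x(2) y(2)
    by (metis dvd_diff dvd_triv_left)
  then have "even (p * p' - D * t * t')" by (simp add: algebra_simps)
  then obtain m where m: "p * p' - D * t * t' = 2 * m" by (elim evenE)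
  have "2 * (x + y) = of_int (p + p') + of_int (t + t') * \<rho>"
    using x y by (simp add: algebra_simps)
  moreover have "(p + p')\<^sup>2 - D * (t + t')\<^sup>2 = (p\<^sup>2 - D * t\<^sup>2) + (p'\<^sup>2 - D * t'\<^sup>2) + 2 * (p * p' - D * t * t')"
    by (simp add: power2_eq_square algebra_simps)
  then have "(p + p')\<^sup>2 - D * (t + t')\<^sup>2 = 4 * (n + n' + m)"
    unfolding x y m by simp
  ultimately show ?thesis unfolding OK_iff by (metis dvd_triv_left)
qed

lemma OK_diff: "x \<in> OK \<Longrightarrow> y \<in> OK \<Longrightarrow> x - y \<in> OK"
  using OK_add[of x "of_int (-1) * y"] OK_mult[of "of_int (-1)" y] OK_of_int[of "-1"] by simp

lemma OK_power: "x \<in> OK \<Longrightarrow> x ^ n \<in> OK"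
  by (induction n) (auto intro: OK_mult)

lemmas OK_intros = OK_add OK_mult OK_diff OK_power

lemma OK_rat_int:
  assumes "x \<in> OK" "of_int b * x = of_int a" "b \<noteq> 0"
  shows "x \<in> \<int>"
proof (rule rational_algebraic_int_is_int)
  show "algebraic_int x" using assms by (simp add: ring_of_integers_def)
  have "x = of_int a / of_int b" using assms by (simp add: field_simps)
  then show "x \<in> \<rat>" by auto
qed

lemma OK_sqrt:
  assumes "x \<in> K" "x\<^sup>2 \<in> OK"
  shows "x \<in> OK"
proof -
  have "algebraic_int x"
    by (rule algebraic_int_root[of "x\<^sup>2" "monom 1 2"])
      (use assms in \<open>auto simp: ring_of_integers_def poly_monom degree_monom_eq\<close>)
  with assms show ?thesis by (simp add: ring_of_integers_def)
qed

text \<open>The value of \<open>irr\<close> is junk outside the ring of integers.\<close>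

definition irr :: "complex \<Rightarrow> int" where
  "irr x = (THE t. \<exists>p. 2 * x = of_int p + of_int t * \<rho>)"

lemma irr_eq: "2 * x = of_int p + of_int t * \<rho> \<Longrightarrow> irr x = t"
  unfolding irr_def by (rule the_equality) (auto dest: independent_int)

lemma irr_of_int [simp]: "irr (of_int a) = 0"
  by (rule irr_eq[of _ "2 * a"]) simp

lemma irr_add: "x \<in> OK \<Longrightarrow> y \<in> OK \<Longrightarrow> irr (x + y) = irr x + irr y"
proof -
  assume "x \<in> OK" "y \<in> OK"
  then obtain p t p' t' where "2 * x = of_int p + of_int t * \<rho>" "2 * y = of_int p' + of_int t' * \<rho>"
    by (auto simp: OK_iff)
  moreover from this have "2 * (x + y) = of_int (p + p') + of_int (t + t') * \<rho>"
    by (simp add: algebra_simps)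
  ultimately show ?thesis using irr_eq by metis
qed

lemma irr_mult_int: "x \<in> OK \<Longrightarrow> irr (of_int a * x) = a * irr x"
proof -
  assume "x \<in> OK"
  then obtain p t where "2 * x = of_int p + of_int t * \<rho>"
    by (auto simp: OK_iff)
  moreover have "2 * (of_int a * x) = of_int a * (2 * x)" by simp
  ultimately have "2 * (of_int a * x) = of_int (a * p) + of_int (a * t) * \<rho>"
    by (simp add: algebra_simps)
  moreover have "irr x = t" by (rule irr_eq) fact
  ultimately show ?thesis using irr_eq by metis
qed

lemma irr_eq_0_Ints:
  assumes "x \<in> OK" "irr x = 0"
  shows "x \<in> \<int>"
proof -
  obtain p t where "2 * x = of_int p + of_int t * \<rho>"
    using assms(1) by (auto simp: OK_iff)
  moreover from this have "t = 0" using assms(2) irr_eq by simp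
  ultimately show ?thesis by (intro OK_rat_int[OF assms(1), of 2 p]) auto
qed

section \<open>Pell equations in the ring of integers and a bound on irrational parts\<close>

definition pell_d :: int where "pell_d = (if D > 0 then D else 3)"

text \<open>The factor 2 gives the second unknown integral coordinates \<open>r\<close> and
  \<open>s\<close>. The coordinates of \<open>2 * x\<close> are then even, since odd ones contradict
  p q = 4 d r s, and after halving \<open>pell_coordinates\<close> applies.\<close>

lemma pell_solutions_Ints:
  assumes "x \<in> OK" "y \<in> OK" "x\<^sup>2 = of_int pell_d * (2 * y)\<^sup>2 + 1"
  shows "x \<in> \<int>" "2 * y \<in> \<int>"
proof -
  obtain p q where x: "2 * x = of_int p + of_int q * \<rho>" "4 dvd p\<^sup>2 - D * q\<^sup>2"
    using assms(1) unfolding OK_iff by auto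
  obtain r s where y: "2 * y = of_int r + of_int s * \<rho>"
    using assms(2) unfolding OK_iff by auto
  have "(2 * x)\<^sup>2 = 4 + 4 * of_int pell_d * (2 * y)\<^sup>2" using assms(3) by simp
  then have "(of_int p + of_int q * \<rho>)\<^sup>2 = 4 + 4 * of_int pell_d * (of_int r + of_int s * \<rho>)\<^sup>2"
    unfolding x y .
  moreover have "(of_int p + of_int q * \<rho>)\<^sup>2 = of_int (p\<^sup>2 + D * q\<^sup>2) + of_int (2 * p * q) * \<rho>"
    by (simp add: power2_eq_square algebra_simps rho_mult)
  moreover have "4 + 4 * of_int pell_d * (of_int r + of_int s * \<rho>)\<^sup>2
      = of_int (4 + 4 * pell_d * (r\<^sup>2 + D * s\<^sup>2)) + of_int (8 * pell_d * r * s) * \<rho>"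
    by (simp add: power2_eq_square algebra_simps rho_mult)
  ultimately have eqs: "p\<^sup>2 + D * q\<^sup>2 = 4 + 4 * pell_d * (r\<^sup>2 + D * s\<^sup>2)" "2 * p * q = 8 * pell_d * r * s"
    using independent_int by metis+
  have "even p \<and> even q"
  proof (rule ccontr)
    assume "\<not> (even p \<and> even q)"
    then have "odd p" "odd q" using squarefree_norm_parity[OF squarefree_D x(2)] by auto
    moreover have "p * q = 4 * (pell_d * r * s)" using eqs(2) by simp
    ultimately show False by (metis dvd_mult2 even_mult_iff even_numeral)
  qed
  then obtain p' q' where pq: "p = 2 * p'" "q = 2 * q'" by (auto elim!: evenE)
  have "q' = 0 \<and> s = 0"
    by (rule pell_coordinates[OF squarefree_D D_nonzero D_not_1 pell_d_def, of p' q' r s])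
      (use eqs in \<open>simp_all add: pq\<close>)
  then have "2 * x = 2 * of_int p'" "2 * y = of_int r" using x(1) y pq by simp_all
  then show "x \<in> \<int>" "2 * y \<in> \<int>" by auto
qed

text \<open>The bound comes from \<open>N(1 + 2 z\<^sup>2) = 2 p\<^sup>2 + (2 n - 1)\<^sup>2\<close> for \<open>z\<close> of trace \<open>p\<close> and norm \<open>n\<close>.\<close>

lemma irr_bound:
  assumes z: "z \<in> OK" and v: "v \<in> OK" and y: "of_int y = (1 + 2 * z\<^sup>2) * v" "y \<noteq> 0"
  shows "\<bar>irr z\<bar> \<le> 2 * \<bar>y\<bar>"
proof -
  obtain p t n where pt: "2 * z = of_int p + of_int t * \<rho>" "p\<^sup>2 - D * t\<^sup>2 = 4 * n"
    using z unfolding OK_iff by auto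
  obtain p' t' n' where pt': "2 * v = of_int p' + of_int t' * \<rho>" "p'\<^sup>2 - D * t'\<^sup>2 = 4 * n'"
    using v unfolding OK_iff by auto
  \<comment> \<open>\<open>a\<close> and \<open>b\<close> are the coordinates of 2 (1 + 2
    z^2).\<close>
  define a where "a = 2 + p\<^sup>2 + D * t\<^sup>2"
  define b where "b = 2 * p * t"
  have "of_int (4 * y) = (2 + (2 * z)\<^sup>2) * (2 * v)" using y(1) by (simp add: power2_eq_square algebra_simps)
  also have "\<dots> = (of_int a + of_int b * \<rho>) * (of_int p' + of_int t' * \<rho>)"
    unfolding pt(1) pt'(1) by (simp add: a_def b_def power2_eq_square algebra_simps rho_mult)
  also have "\<dots> = of_int (a * p' + D * b * t') + of_int (a * t' + b * p') * \<rho>"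
    by (simp add: algebra_simps rho_mult)
  finally have "of_int (4 * y) + of_int 0 * \<rho> = of_int (a * p' + D * b * t') + of_int (a * t' + b * p') * \<rho>"
    by simp
  from independent_int[OF this] have e: "a * p' + D * b * t' = 4 * y" "a * t' + b * p' = 0" by simp_all
  have "(a * p' + D * b * t')\<^sup>2 - D * (a * t' + b * p')\<^sup>2 = (a\<^sup>2 - D * b\<^sup>2) * (p'\<^sup>2 - D * t'\<^sup>2)"
    by (simp add: power2_eq_square algebra_simps)
  moreover have "a\<^sup>2 - D * b\<^sup>2 = 4 + 4 * (2 * p\<^sup>2 - (p\<^sup>2 - D * t\<^sup>2)) + (p\<^sup>2 - D * t\<^sup>2)\<^sup>2"
    by (simp add: a_def b_def power2_eq_square algebra_simps)
  then have "a\<^sup>2 - D * b\<^sup>2 = 4 * (2 * p\<^sup>2 + (2 * n - 1)\<^sup>2)"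
    unfolding pt(2) by (simp add: power2_eq_square algebra_simps)
  ultimately have "(4 * y)\<^sup>2 = 4 * (2 * p\<^sup>2 + (2 * n - 1)\<^sup>2) * (4 * n')" using e pt'(2) by simp
  then have "4 * ((2 * p\<^sup>2 + (2 * n - 1)\<^sup>2) * n') = 4 * y\<^sup>2" by (simp add: power_mult_distrib)
  then have eq: "(2 * p\<^sup>2 + (2 * n - 1)\<^sup>2) * n' = y\<^sup>2" by (simp only: mult_left_cancel[OF zero_neq_numeral[symmetric]])
  define f where "f = 2 * p\<^sup>2 + (2 * n - 1)\<^sup>2"
  have f0: "f \<ge> 0" by (simp add: f_def)
  \<comment> \<open>\<open>f\<close> is the norm of 1 + 2 z^2 and \<open>n'\<close> that of
    \<open>v\<close>. Their product is y^2, so positivity of \<open>n'\<close> gives f <=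
    y^2.\<close>
  have "n' > 0"
  proof (rule ccontr)
    assume "\<not> n' > 0"
    then have "f * n' \<le> 0" using f0 by (simp add: mult_nonneg_nonpos)
    then show False using eq y(2) unfolding f_def by (smt (verit) zero_less_power2)
  qed
  then have "f * 1 \<le> f * n'" using f0 by (intro mult_left_mono) auto
  then have fy: "f \<le> y\<^sup>2" using eq unfolding f_def by simp
  have n4: "\<bar>n\<bar> \<le> (2 * n - 1)\<^sup>2"
  proof -
    consider "n \<ge> 1" | "n = 0" | "n \<le> -1" by linarith
    then show ?thesis
    proof cases
      case 1
      then have "(2 * n - 1) * 1 \<le> (2 * n - 1) * (2 * n - 1)" by (intro mult_left_mono) auto
      moreover have "\<bar>n\<bar> \<le> (2 * n - 1) * 1" using 1 by simp
      ultimately show ?thesis unfolding power2_eq_square by (rule order.trans[rotated])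
    next
      case 3
      then have "(1 - 2 * n) * 1 \<le> (1 - 2 * n) * (1 - 2 * n)" by (intro mult_left_mono) auto
      moreover have "\<bar>n\<bar> \<le> (1 - 2 * n) * 1" using 3 by simp
      ultimately show ?thesis unfolding power2_commute[of "2 * n" 1] unfolding power2_eq_square
        by (rule order.trans[rotated])
    qed auto
  qed
  \<comment> \<open>Here D t^2 = p^2 - 4 n, and \<open>f\<close> controls both p^2 and |n|.\<close>
  have "1 * t\<^sup>2 \<le> \<bar>D\<bar> * t\<^sup>2" using D_nonzero by (intro mult_right_mono) auto
  also have "\<dots> = \<bar>D * t\<^sup>2\<bar>" by (simp add: abs_mult)
  also have "\<dots> = \<bar>p\<^sup>2 - 4 * n\<bar>" using pt(2) by (simp add: algebra_simps)
  also have "\<dots> \<le> 4 * f" using n4 unfolding f_def by (smt (verit) zero_le_power2)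
  also have "\<dots> \<le> (2 * y)\<^sup>2" using fy by (simp add: power2_eq_square)
  finally have "t\<^sup>2 \<le> (2 * y)\<^sup>2" by simp
  then have "\<bar>t\<bar> \<le> \<bar>2 * y\<bar>" by (simp add: abs_le_square_iff)
  then show ?thesis using irr_eq[OF pt(1)] by simp
qed

end

section \<open>Existence of Pell solutions\<close>

text \<open>Dirichlet approximation yields infinitely many reduced fractions h / k for which h^2 - n
  k^2 is bounded. Two of them agree in this value and are congruent modulo it; the quotient of the
  corresponding h + k sqrt n is a solution.\<close>

lemma pell_solution_exists:
  fixes n :: int
  assumes n: "n > 0" "\<And>x. x\<^sup>2 \<noteq> n"
  shows "\<exists>x y. y \<noteq> 0 \<and> x\<^sup>2 = n * y\<^sup>2 + 1"
proof -
  define \<theta> where "\<theta> = sqrt (of_int n)"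
  have \<theta>: "\<theta> \<ge> 0" "\<theta>\<^sup>2 = of_int n" using n by (auto simp: \<theta>_def)
  have "\<theta> \<notin> \<rat>"
  proof
    assume "\<theta> \<in> \<rat>"
    moreover have "algebraic_int \<theta>" unfolding \<theta>_def by (intro algebraic_int_sqrt int_imp_algebraic_int) auto
    ultimately obtain m where m: "\<theta> = of_int m" using rational_algebraic_int_is_int by (auto elim: Ints_cases)
    with \<theta> have "real_of_int (m\<^sup>2) = of_int n" by simp
    then have "m\<^sup>2 = n" by (simp only: of_int_eq_iff)
    with n show False by blast
  qed
  then have inf: "infinite (approx_set \<theta>)" using rational_iff_finite_approx_set by blast
  define N where "N = (\<lambda>(h, k). h\<^sup>2 - n * k\<^sup>2)"
  define f where "f = (\<lambda>z. (N z, fst z mod N z, snd z mod N z))"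
  define B where "B = \<lceil>2 * \<theta> + 1\<rceil>"
  have N_bound: "\<bar>N z\<bar> \<le> B \<and> N z \<noteq> 0" if zA: "z \<in> approx_set \<theta>" for z
  proof -
    obtain h k where z: "z = (h, k)" "k > 0" "\<bar>\<theta> - of_int h / of_int k\<bar> < 1 / (of_int k)\<^sup>2"
      using zA by (auto simp: approx_set_def)
    define e where "e = of_int h - of_int k * \<theta>"
    have k1: "real_of_int k \<ge> 1" using z by simp
    have "\<bar>e\<bar> = of_int k * \<bar>\<theta> - of_int h / of_int k\<bar>"
    proof -
      have "e = of_int k * - (\<theta> - of_int h / of_int k)" using z(2) by (simp add: e_def right_diff_distrib)
      then show ?thesis using z(2) by (simp add: abs_mult)
    qed
    also have "\<dots> \<le> of_int k * (1 / (of_int k)\<^sup>2)" using z by (intro mult_left_mono) auto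
    finally have e: "\<bar>e\<bar> \<le> 1 / of_int k" using z(2) by (simp add: power2_eq_square)
    have e1: "1 / real_of_int k \<le> 1" using k1 by simp
    \<comment> \<open>The second factor is the conjugate h + k \<theta>, written in terms of the
      small error \<open>e\<close>.\<close>
    have "real_of_int (N z) = e * (2 * of_int k * \<theta> + e)"
    proof -
      have "e * (2 * of_int k * \<theta> + e) = (of_int h)\<^sup>2 - (of_int k)\<^sup>2 * \<theta>\<^sup>2"
        by (simp add: e_def power2_eq_square algebra_simps)
      then show ?thesis using \<theta>(2) z(1) by (simp add: N_def)
    qed
    then have "\<bar>real_of_int (N z)\<bar> = \<bar>e\<bar> * \<bar>2 * of_int k * \<theta> + e\<bar>" by (simp only: abs_mult)
    also have "\<dots> \<le> (1 / of_int k) * (2 * of_int k * \<theta> + 1)"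
    proof (rule mult_mono)
      have "\<bar>2 * of_int k * \<theta>\<bar> = 2 * of_int k * \<theta>" using k1 \<theta>(1) by simp
      then show "\<bar>2 * of_int k * \<theta> + e\<bar> \<le> 2 * of_int k * \<theta> + 1"
        using e e1 abs_triangle_ineq[of "2 * of_int k * \<theta>" e] by linarith
    qed (use e k1 in auto)
    also have "\<dots> \<le> 2 * \<theta> + 1" using k1 by (simp add: distrib_left)
    finally have "real_of_int \<bar>N z\<bar> \<le> 2 * \<theta> + 1" by simp
    then have "\<bar>N z\<bar> \<le> B" unfolding B_def by linarith
    moreover have "N z \<noteq> 0"
    proof
      assume "N z = 0"
      then have "(of_int h / of_int k)\<^sup>2 = (\<theta>)\<^sup>2"
        using z(1,2) \<theta>(2) by (simp add: N_def power_divide divide_eq_eq flip: of_int_power of_int_mult)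
      then have "\<theta> = of_int h / of_int k \<or> \<theta> = - (of_int h / of_int k)"
        by (metis power2_eq_iff)
      then have "\<theta> \<in> \<rat>" by auto
      then show False using \<open>\<theta> \<notin> \<rat>\<close> by simp
    qed
    ultimately show ?thesis by simp
  qed
  have "f ` approx_set \<theta> \<subseteq> {-B..B} \<times> {-B..B} \<times> {-B..B}"
  proof
    fix w assume "w \<in> f ` approx_set \<theta>"
    then obtain z where z: "z \<in> approx_set \<theta>" "w = f z" by auto
    have "\<bar>x mod N z\<bar> \<le> B" for x
      using N_bound[OF z(1)] abs_mod_less[of "N z" x] by linarith
    then show "w \<in> {-B..B} \<times> {-B..B} \<times> {-B..B}"
      using N_bound[OF z(1)] z(2) by (auto simp: f_def abs_le_iff minus_le_iff)
  qed
  then have "finite (f ` approx_set \<theta>)" by (rule finite_subset) auto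
  from pigeonhole_infinite[OF inf this] obtain z
    where z: "z \<in> approx_set \<theta>" "infinite {z' \<in> approx_set \<theta>. f z' = f z}" by blast
  have "{z' \<in> approx_set \<theta>. f z' = f z} \<noteq> {z}" using z(2) by (metis finite.emptyI finite_insert)
  then obtain z' where z': "z' \<in> approx_set \<theta>" "f z' = f z" "z' \<noteq> z" using z(1) by blast
  obtain h k where hk: "z = (h, k)" "k > 0" "coprime h k" using z(1) by (auto simp: approx_set_def)
  obtain h' k' where hk': "z' = (h', k')" "k' > 0" "coprime h' k'" using z'(1) by (auto simp: approx_set_def)
  define c where "c = N z"
  have c: "h\<^sup>2 - n * k\<^sup>2 = c" "h'\<^sup>2 - n * k'\<^sup>2 = c" "h mod c = h' mod c" "k mod c = k' mod c" "c \<noteq> 0"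
    using z'(2) N_bound[OF z(1)] by (auto simp: f_def c_def hk hk' N_def)
  have "c dvd h - h'" "c dvd k - k'" using c by (auto simp: mod_eq_dvd_iff)
  then obtain s t where "h - h' = c * s" "k - k' = c * t" by (auto elim!: dvdE)
  then have st: "h' = h - c * s" "k' = k - c * t" by auto
  \<comment> \<open>\<open>X\<close> and \<open>- Y\<close> are the coordinates of (h + k sqrt n)
    (h' - k' sqrt n) / c; the congruences modulo \<open>c\<close> make them integral.\<close>
  define X where "X = 1 - h * s + n * k * t"
  define Y where "Y = k * s - h * t"
  have X: "h * h' - n * k * k' = c * X"
  proof -
    have "h * h' - n * k * k' = (h\<^sup>2 - n * k\<^sup>2) - c * (h * s - n * k * t)"
      unfolding st by (simp add: power2_eq_square algebra_simps)
    then show ?thesis unfolding c(1) X_def by (simp add: algebra_simps)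
  qed
  have Y: "h * k' - k * h' = c * Y"
    unfolding st Y_def by (simp add: algebra_simps)
  have "c\<^sup>2 * (X\<^sup>2 - n * Y\<^sup>2) = (c * X)\<^sup>2 - n * (c * Y)\<^sup>2" by (simp add: power2_eq_square algebra_simps)
  also have "\<dots> = (h\<^sup>2 - n * k\<^sup>2) * (h'\<^sup>2 - n * k'\<^sup>2)"
    unfolding X[symmetric] Y[symmetric] by (simp add: power2_eq_square algebra_simps)
  also have "\<dots> = c\<^sup>2 * 1" unfolding c by (simp add: power2_eq_square)
  finally have "X\<^sup>2 = n * Y\<^sup>2 + 1" using c(5) by simp
  \<comment> \<open>Otherwise the two fractions are equal, and being reduced with positive
    denominators they come from the same pair.\<close>
  moreover have "Y \<noteq> 0"
  proof
    assume "Y = 0"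
    then have "h * k' = k * h'" using Y by simp
    then have "k dvd k'" "k' dvd k" using hk(3) hk'(3)
      by (metis coprime_commute coprime_dvd_mult_right_iff dvd_triv_left)
         (metis \<open>h * k' = k * h'\<close> coprime_commute coprime_dvd_mult_left_iff dvd_triv_right hk'(3))
    then have "k = k'" using hk(2) hk'(2) by (simp add: zdvd_antisym_nonneg)
    then have "h = h'" using \<open>h * k' = k * h'\<close> hk(2) by simp
    then show False using z'(3) hk hk' \<open>k = k'\<close> by simp
  qed
  ultimately show ?thesis by blast
qed

text \<open>Chinese remaindering: 2 is invertible modulo the odd part of \<open>y\<close>, and 3 is
  invertible modulo the power of 2.\<close>

lemma exists_multiple_of_half_third:
  fixes y :: int
  assumes "y \<noteq> 0"
  shows "\<exists>k. y dvd (2 * k - 1) * (3 * k - 1)"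
proof -
  obtain b where b: "y = 2 ^ multiplicity 2 y * b" "odd b"
    using multiplicity_decompose'[OF assms, of 2] by auto
  define e where "e = multiplicity 2 y"
  have eb: "y = 2 ^ e * b" "odd b" using b by (simp_all add: e_def)
  have "coprime (2 ^ e) b" using eb(2) by simp
  have "coprime (2 ^ e) (3::int)" by simp
  obtain u v where uv: "u * 2 ^ e + v * b = 1" using \<open>coprime (2 ^ e) b\<close>
    by (metis bezout_int coprime_iff_gcd_eq_1)
  obtain u' v' where uv': "u' * 2 ^ e + v' * 3 = (1::int)" using \<open>coprime (2 ^ e) (3::int)\<close>
    by (metis bezout_int coprime_iff_gcd_eq_1)
  obtain g where g: "b = 2 * g - 1" using eb(2) by (elim oddE) (simp add: that[of "_ + 1"])
  \<comment> \<open>\<open>g\<close> and \<open>v'\<close> invert 2 modulo \<open>b\<close> and 3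
    modulo \<open>2 ^ e\<close>; \<open>u * 2 ^ e\<close> and \<open>v * b\<close> are the
    corresponding idempotents.\<close>
  define k where "k = g * (u * 2 ^ e) + v' * (v * b)"
  have "2 * k - 1 = (2 * g - 1) * (u * 2 ^ e) + (2 * v' - 1) * (v * b) + (u * 2 ^ e + v * b - 1)"
    by (simp add: k_def algebra_simps)
  then have k2: "2 * k - 1 = b * (u * 2 ^ e + (2 * v' - 1) * v)"
    unfolding g[symmetric] uv by (simp add: algebra_simps)
  have "3 * k - 1 = (3 * g - 1) * (u * 2 ^ e) + (3 * v' - 1) * (v * b) + (u * 2 ^ e + v * b - 1)"
    by (simp add: k_def algebra_simps)
  moreover have "3 * v' - 1 = - u' * 2 ^ e" using uv' by simp
  ultimately have "3 * k - 1 = (3 * g - 1) * (u * 2 ^ e) + (- u' * 2 ^ e) * (v * b)"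
    using uv by simp
  then have "3 * k - 1 = 2 ^ e * ((3 * g - 1) * u - u' * v * b)" by (simp add: algebra_simps)
  with k2 have "(2 * k - 1) * (3 * k - 1) = y * ((u * 2 ^ e + (2 * v' - 1) * v) * ((3 * g - 1) * u - u' * v * b))"
    using eb(1) by simp
  then show ?thesis by (metis dvd_triv_left)
qed

text \<open>The solutions are the powers of a + sqrt (a^2 - 1). Modulo a - 1 the radicand vanishes,
  so at each multiplication the first coordinate stays 1 and the second grows by 1. Negative
  residues come from changing the sign of \<open>V\<close>.\<close>

lemma pell_second_coordinate_cong:
  fixes a m :: int
  shows "\<exists>X V. X\<^sup>2 = (a\<^sup>2 - 1) * V\<^sup>2 + 1 \<and> a - 1 dvd V - m"
proof -
  have nat: "\<exists>X V. X\<^sup>2 = (a\<^sup>2 - 1) * V\<^sup>2 + 1 \<and> a - 1 dvd V - int n \<and> a - 1 dvd X - 1" for n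
  proof (induction n)
    case 0
    then show ?case by (intro exI[of _ 1] exI[of _ 0]) simp
  next
    case (Suc n)
    then obtain X V s t where *: "X\<^sup>2 = (a\<^sup>2 - 1) * V\<^sup>2 + 1" "V - int n = (a - 1) * s" "X - 1 = (a - 1) * t"
      by (auto elim!: dvdE)
    have "(a * X + (a\<^sup>2 - 1) * V)\<^sup>2 - (a\<^sup>2 - 1) * (X + a * V)\<^sup>2 = X\<^sup>2 - (a\<^sup>2 - 1) * V\<^sup>2"
      by (simp add: power2_eq_square algebra_simps)
    then have "(a * X + (a\<^sup>2 - 1) * V)\<^sup>2 = (a\<^sup>2 - 1) * (X + a * V)\<^sup>2 + 1" using *(1) by simp
    moreover have "(X + a * V) - int (Suc n) = (X - 1) + (V - int n) + (a - 1) * V" by (simp add: algebra_simps)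
    then have "(X + a * V) - int (Suc n) = (a - 1) * (t + s + V)"
      unfolding *(2,3) by (simp only: distrib_left)
    moreover have "(a * X + (a\<^sup>2 - 1) * V) - 1 = (X - 1) + (a - 1) * (X + (a + 1) * V)"
      by (simp add: power2_eq_square algebra_simps)
    then have "(a * X + (a\<^sup>2 - 1) * V) - 1 = (a - 1) * (t + X + (a + 1) * V)"
      unfolding *(3) by (simp only: distrib_left add.assoc)
    ultimately show ?case by (metis dvd_triv_left)
  qed
  show ?thesis
  proof (cases "m \<ge> 0")
    case True
    then show ?thesis using nat[of "nat m"] by auto
  next
    case False
    then obtain X V where XV: "X\<^sup>2 = (a\<^sup>2 - 1) * V\<^sup>2 + 1" "a - 1 dvd V + m" using nat[of "nat (- m)"] by auto
    have "(- V) - m = - (V + m)" by simp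
    then have "a - 1 dvd (- V) - m" using XV(2) by (simp only: dvd_minus_iff)
    then show ?thesis using XV(1) by (metis power2_minus)
  qed
qed

section \<open>The combined equation\<close>

text \<open>Generic in the ring, as are the definitions that follow, so that integers, complex
  values and polynomials can be inserted alike.\<close>

primrec bound_prod :: "(nat \<Rightarrow> 'a::comm_ring_1) \<Rightarrow> nat \<Rightarrow> 'a" where
  "bound_prod z 0 = 1"
| "bound_prod z (Suc i) = bound_prod z i * (1 + 2 * (z i * z i))"

primrec digits :: "'a::comm_ring_1 \<Rightarrow> (nat \<Rightarrow> 'a) \<Rightarrow> nat \<Rightarrow> 'a" where
  "digits w z 0 = 0"
| "digits w z (Suc i) = digits w z i * w + z i"

text \<open>If c = 1 + 2 q T for one stage T, the next stage gives 2 c^2 - 1, the Chebyshev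
  polynomial that doubles the index of a Pell solution. The initial value 1 + 2 d q is itself 2 x^2
  - 1 when x^2 = d q + 1.\<close>

primrec tower :: "'a::comm_ring_1 \<Rightarrow> 'a \<Rightarrow> nat \<Rightarrow> 'a" where
  "tower d q 0 = d"
| "tower d q (Suc i) = 4 * tower d q i * (1 + q * tower d q i)"

text \<open>The result is the product of X - y (a + 2 b) over both signs of the square roots a of
  \<open>A1\<close> and b of \<open>A2\<close>, hence free of radicals. With c = 1 + 2 q p, the
  radicand \<open>A2\<close> is (c^2 - 1) V^2 + 1.\<close>

definition core_poly :: "'a::comm_ring_1 \<Rightarrow> nat \<Rightarrow> (nat \<Rightarrow> 'a) \<Rightarrow> 'a \<Rightarrow> 'a \<Rightarrow> 'a \<Rightarrow> 'a \<Rightarrow> 'a" where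
  "core_poly d n z N u k j =
    (let y = 2 * N * bound_prod z n * u; q = y * y; p = tower d q n;
         V = digits (4 * q) z n + k * y * p;
         A1 = d * q + 1; A2 = q * tower d q (Suc n) * (V * V) + 1;
         X = y * j - (2 * k - 1) * (3 * k - 1);
         B = X * X - q * A1 - 4 * q * A2
     in B * B - 16 * (q * q) * A1 * A2)"

lemma of_int_bound_prod: "of_int (bound_prod z n) = bound_prod (\<lambda>i. of_int (z i)) n"
  by (induction n) auto

lemma of_int_digits: "of_int (digits w z n) = digits (of_int w) (\<lambda>i. of_int (z i)) n"
  by (induction n) auto

lemma of_int_tower: "of_int (tower d q n) = tower (of_int d) (of_int q) n"
  by (induction n) auto

lemma of_int_core_poly:
  "of_int (core_poly d n z N u k j) =
     core_poly (of_int d) n (\<lambda>i. of_int (z i)) (of_int N) (of_int u) (of_int k) (of_int j)"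
  by (simp add: core_poly_def Let_def of_int_bound_prod of_int_digits of_int_tower)

section \<open>Squares, growth and digit expansions over the integers\<close>

lemma bound_prod_nonzero: "bound_prod (z :: nat \<Rightarrow> int) n \<noteq> 0"
proof (induction n)
  case (Suc n)
  have "1 + 2 * (z n * z n) \<noteq> 0" by presburger
  with Suc show ?case by simp
qed simp

text \<open>1 + q T is x^2 at the first stage and (1 + 2 q T')^2 at a stage T that follows T'. So
  each step multiplies by 4 times a square and preserves the shape d (2 g)^2.\<close>

lemma tower_square:
  fixes d y x :: int
  assumes "x\<^sup>2 = d * y\<^sup>2 + 1"
  shows "\<exists>g. tower d (y * y) (Suc n) = d * (2 * g)\<^sup>2 \<and> (\<exists>h. 1 + (y * y) * tower d (y * y) n = h\<^sup>2)"
proof (induction n)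
  case 0
  have "1 + (y * y) * tower d (y * y) 0 = x\<^sup>2" using assms by (simp add: power2_eq_square algebra_simps)
  moreover from this have "tower d (y * y) (Suc 0) = d * (2 * x)\<^sup>2" by (simp add: power2_eq_square algebra_simps)
  ultimately show ?case by blast
next
  case (Suc n)
  define p where "p = tower d (y * y) (Suc n)"
  obtain g where g: "p = d * (2 * g)\<^sup>2" using Suc unfolding p_def by blast
  define e where "e = (y * y) * tower d (y * y) n"
  have "1 + (y * y) * p = (1 + 2 * e)\<^sup>2" by (simp add: p_def e_def power2_eq_square algebra_simps)
  moreover from this have "4 * p * (1 + (y * y) * p) = d * (2 * (2 * g * (1 + 2 * e)))\<^sup>2"
    unfolding g by (simp add: power2_eq_square algebra_simps)
  ultimately show ?case unfolding p_def[symmetric] tower.simps(2)[of d "y * y" "Suc n"] by blast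
qed

lemma tower_ge_1:
  fixes d q :: int
  assumes "d \<ge> 1" "q \<ge> 0"
  shows "tower d q n \<ge> 1"
proof (induction n)
  case (Suc n)
  have "1 * 1 \<le> (4 * tower d q n) * (1 + q * tower d q n)"
    using Suc assms by (intro mult_mono) auto
  then show ?case by simp
qed (use assms in simp)

text \<open>Each stage is at least 4 q times the square of the previous one. Consequently
  \<open>tower d q n\<close> exceeds every number with \<open>n\<close> digits in base 4 q.\<close>

lemma tower_ge_power:
  fixes d q :: int
  assumes "d \<ge> 1" "q \<ge> 0"
  shows "(4 * q) ^ n \<le> tower d q n"
proof (induction n)
  case (Suc n)
  have t: "tower d q n \<ge> 1" by (rule tower_ge_1) fact+
  then have "tower d q n * 1 \<le> tower d q n * tower d q n" by (intro mult_left_mono) auto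
  have "(4 * q) ^ Suc n \<le> (4 * q) * tower d q n" using Suc assms by (simp add: mult_left_mono)
  also have "\<dots> * 1 \<le> (4 * q) * tower d q n * tower d q n" using t assms by (intro mult_left_mono) auto
  also have "\<dots> \<le> tower d q (Suc n)" using t by (simp add: algebra_simps)
  finally show ?case by simp
qed (use assms in simp)

lemma digits_bound:
  fixes w :: int
  assumes "\<And>i. i < n \<Longrightarrow> \<bar>t i\<bar> \<le> w - 1" "w \<ge> 1"
  shows "\<bar>digits w t n\<bar> \<le> w ^ n - 1"
  using assms
proof (induction n)
  case (Suc n)
  have "\<bar>digits w t (Suc n)\<bar> \<le> \<bar>digits w t n\<bar> * w + \<bar>t n\<bar>"
    using Suc.prems by (simp add: abs_mult order.trans[OF abs_triangle_ineq])
  also have "\<dots> \<le> (w ^ n - 1) * w + (w - 1)"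
    using Suc by (intro add_mono mult_right_mono) auto
  finally show ?case by (simp add: algebra_simps)
qed simp

text \<open>The last digit is a multiple of the base, so it is 0 and can be stripped; the digits may
  be negative.\<close>

lemma digits_eq_0:
  fixes w :: int
  assumes "\<And>i. i < n \<Longrightarrow> \<bar>t i\<bar> < w" "digits w t n = 0" "i < n"
  shows "t i = 0"
  using assms
proof (induction n)
  case (Suc n)
  have "w dvd t n" using Suc.prems(2) by (metis digits.simps(2) dvd_add_right_iff dvd_0_right dvd_triv_right)
  then have tn: "t n = 0" using Suc.prems(1)[of n] zdvd_not_zless[of "\<bar>t n\<bar>" w] by force
  have w: "w > 0" using Suc.prems(1)[of n] by simp
  then have "digits w t n = 0" using Suc.prems(2) tn by simp
  then show ?case using Suc tn by (cases "i = n") auto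
qed simp

lemma core_poly_factorization:
  fixes a b X q :: "'a::comm_ring_1"
  assumes "a\<^sup>2 = A1" "b\<^sup>2 = A2" "q = y * y"
  defines "B \<equiv> X * X - q * A1 - 4 * q * A2"
  shows "B * B - 16 * (q * q) * A1 * A2 =
    (X - y * (a + 2 * b)) * (X - y * (a - 2 * b)) * (X + y * (a + 2 * b)) * (X + y * (a - 2 * b))"
  unfolding B_def assms(1,2)[symmetric] assms(3) by (simp add: algebra_simps power2_eq_square)

section \<open>Zeros of the core polynomial over the integers and over the ring of integers of
  K\<close>

context quadratic_field begin

lemma core_poly_solvable:
  assumes N: "N \<noteq> 0"
  shows "\<exists>u k j. core_poly pell_d n (z :: nat \<Rightarrow> int) N u k j = 0"
proof -
  have d: "pell_d > 0" "pell_d \<noteq> 1" "squarefree pell_d"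
    using D_nonzero D_not_1 squarefree_D by (auto simp: pell_d_def intro!: squarefree_prime)
  define c where "c = 2 * N * bound_prod z n"
  have c0: "c \<noteq> 0" using N bound_prod_nonzero by (simp add: c_def)
  have "x\<^sup>2 \<noteq> pell_d * c\<^sup>2" for x
    using squarefree_mult_square_eq_square[of pell_d x c] d c0 by auto
  moreover have "pell_d * c\<^sup>2 > 0" using d c0 by simp
  \<comment> \<open>Putting c^2 into the radicand makes the second coordinate \<open>c * u\<close>
    of the Pell solution for \<open>pell_d\<close> a multiple of \<open>c\<close>.\<close>
  ultimately obtain x u where u: "u \<noteq> 0" "x\<^sup>2 = pell_d * c\<^sup>2 * u\<^sup>2 + 1"
    using pell_solution_exists by blast
  define y where "y = c * u"
  have y0: "y \<noteq> 0" and x: "x\<^sup>2 = pell_d * y\<^sup>2 + 1" using c0 u by (simp_all add: y_def power_mult_distrib)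
  define q where "q = y * y"
  define p where "p = tower pell_d q n"
  define s where "s = digits (4 * q) z n"
  obtain \<kappa> where \<kappa>: "y dvd (2 * \<kappa> - 1) * (3 * \<kappa> - 1)"
    using exists_multiple_of_half_third[OF y0] by blast
  define a where "a = 1 + 2 * q * p"
  \<comment> \<open>Since a - 1 = 2 y (y p), every \<open>V\<close> in this residue class has the
    form s + k y p with \<open>k\<close> congruent to \<kappa> modulo \<open>y\<close>.\<close>
  obtain X V where XV: "X\<^sup>2 = (a\<^sup>2 - 1) * V\<^sup>2 + 1" "a - 1 dvd V - (s + \<kappa> * y * p)"
    using pell_second_coordinate_cong by blast
  obtain e where "V - (s + \<kappa> * y * p) = (a - 1) * e" using XV(2) by (elim dvdE)
  define k where "k = \<kappa> + 2 * y * e"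
  have V: "V = s + k * y * p"
    using \<open>V - (s + \<kappa> * y * p) = (a - 1) * e\<close> by (simp add: k_def a_def q_def algebra_simps)
  have "(2 * k - 1) * (3 * k - 1) = (2 * \<kappa> - 1) * (3 * \<kappa> - 1) + y * (2 * e * (12 * \<kappa> - 5 + 12 * y * e))"
    by (simp add: k_def algebra_simps)
  then have "y dvd (2 * k - 1) * (3 * k - 1)" using \<kappa> by simp
  then obtain f where f: "(2 * k - 1) * (3 * k - 1) = y * f" by (elim dvdE)
  have a2: "a\<^sup>2 - 1 = q * tower pell_d q (Suc n)"
    by (simp add: a_def p_def power2_eq_square algebra_simps)
  \<comment> \<open>This makes y j - (2 k - 1) (3 k - 1) equal to y (x + 2 X), which annihilates the
    first factor of the core polynomial.\<close>
  define j where "j = f + x + 2 * X"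
  have "core_poly pell_d n z N u k j =
    (let A1 = x ^ 2; A2 = X ^ 2; XX = y * j - (2 * k - 1) * (3 * k - 1);
       B = XX * XX - q * A1 - 4 * q * A2 in B * B - 16 * (q * q) * A1 * A2)"
      unfolding core_poly_def Let_def c_def[symmetric] y_def[symmetric] q_def[symmetric]
        p_def[symmetric] s_def[symmetric] V[symmetric] a2[symmetric] XV(1) x
      by (simp add: q_def power2_eq_square)
  also have "\<dots> = 0"
    unfolding Let_def core_poly_factorization[OF refl refl q_def] f j_def
    by (simp add: algebra_simps)
  finally show ?thesis by blast
qed

lemma OK_bound_prod: "(\<And>i. i < n \<Longrightarrow> z i \<in> OK) \<Longrightarrow> bound_prod z n \<in> OK"
  by (induction n) (auto intro!: OK_intros)

lemma OK_digits: "w \<in> OK \<Longrightarrow> (\<And>i. i < n \<Longrightarrow> z i \<in> OK) \<Longrightarrow> digits w z n \<in> OK"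
  by (induction n) (auto intro!: OK_intros)

lemma OK_tower: "d \<in> OK \<Longrightarrow> q \<in> OK \<Longrightarrow> tower d q n \<in> OK"
  by (induction n) (auto intro!: OK_intros)

text \<open>The base is a rational integer, so the additive map \<open>irr\<close> acts digit by
  digit.\<close>

lemma irr_digits:
  "(\<And>i. i < n \<Longrightarrow> z i \<in> OK) \<Longrightarrow> irr (digits (of_int w) z n) = digits w (\<lambda>i. irr (z i)) n"
proof (induction n)
  case (Suc n)
  then have "irr (of_int w * digits (of_int w) z n + z n) = w * irr (digits (of_int w) z n) + irr (z n)"
    by (simp add: irr_add irr_mult_int OK_digits OK_mult)
  with Suc show ?case by (simp add: mult.commute)
qed (use irr_of_int[of 0] in simp)

lemma half_not_OK: "2 * x = of_int (2 * a + 1) \<Longrightarrow> x \<notin> OK"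
proof
  assume x: "2 * x = of_int (2 * a + 1)" "x \<in> OK"
  then have "x \<in> \<int>" by (intro OK_rat_int[of x 2 "2 * a + 1"]) auto
  then obtain b where "x = of_int b" by (elim Ints_cases)
  with x(1) have "of_int (2 * b) = (of_int (2 * a + 1) :: complex)" by simp
  then have "2 * b = 2 * a + 1" by (simp only: of_int_eq_iff)
  then show False by presburger
qed

lemma third_not_OK: "3 * x = 1 \<Longrightarrow> x \<notin> OK"
proof
  assume x: "3 * x = 1" "x \<in> OK"
  then have "x \<in> \<int>" by (intro OK_rat_int[of x 3 1]) auto
  then obtain b where "x = of_int b" by (elim Ints_cases)
  with x(1) have "of_int (3 * b) = (of_int 1 :: complex)" by simp
  then have "3 * b = 1" by (simp only: of_int_eq_iff)
  then show False by presburger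
qed

text \<open>Both square roots are rational functions of their sum and the radicands.\<close>

lemma sqrt_sum_OK:
  assumes "a\<^sup>2 \<in> OK" "b\<^sup>2 \<in> OK" "a + 2 * b \<in> K" "a\<^sup>2 \<noteq> 4 * b\<^sup>2"
  shows "a \<in> OK \<and> b \<in> OK"
proof -
  define \<alpha> where "\<alpha> = a + 2 * b"
  have \<alpha>: "\<alpha> \<noteq> 0"
  proof
    assume "\<alpha> = 0"
    then have "a = - (2 * b)" by (simp add: \<alpha>_def eq_neg_iff_add_eq_0)
    then show False using assms(4) by (simp add: power_mult_distrib)
  qed
  have ac: "of_int i \<in> K" for i using OK_in_K[OF OK_of_int] .
  have "a = (\<alpha>\<^sup>2 + a\<^sup>2 - of_int 4 * b\<^sup>2) / (of_int 2 * \<alpha>)"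
    using \<alpha> by (simp add: eq_divide_eq) (simp add: \<alpha>_def algebra_simps power2_eq_square)
  also have "\<dots> \<in> K"
  proof -
    have "\<alpha> \<in> K" using assms(3) by (simp add: \<alpha>_def)
    moreover from this have "\<alpha>\<^sup>2 \<in> K" by (simp add: power2_eq_square K_mult)
    ultimately show ?thesis using assms(1,2)[THEN OK_in_K]
      by (intro K_divide K_diff K_add K_mult[OF ac]) auto
  qed
  finally have aK: "a \<in> K" .
  have "b = (\<alpha> - a) / of_int 2" by (simp add: \<alpha>_def)
  also have "\<dots> \<in> K" using assms(3) aK unfolding \<alpha>_def by (intro K_divide K_diff ac)
  finally show ?thesis using aK assms OK_sqrt by blast
qed

lemma core_poly_root:
  assumes z: "\<And>i. i < n \<Longrightarrow> z i \<in> OK" and N: "N \<in> OK" and ukj: "u \<in> OK" "k \<in> OK" "j \<in> OK"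
    and root: "core_poly (of_int pell_d) n z N u k j = 0"
  shows "N \<noteq> 0 \<and> (\<forall>i<n. z i \<in> \<int>)"
proof -
  define y' where "y' = N * bound_prod z n * u"
  define y where "y = 2 * y'"
  define q where "q = y * y"
  define d :: complex where "d = of_int pell_d"
  define p where "p = tower d q n"
  define s where "s = digits (4 * q) z n"
  define V where "V = s + k * y * p"
  define A1 where "A1 = d * q + 1"
  define A2 where "A2 = q * tower d q (Suc n) * (V * V) + 1"
  define T where "T = (2 * k - 1) * (3 * k - 1)"
  define X where "X = y * j - T"
  have y'OK: "y' \<in> OK" unfolding y'_def by (intro OK_intros N ukj OK_bound_prod z)
  have yOK: "y \<in> OK" unfolding y_def by (intro OK_intros y'OK OK_numeral)
  have qOK: "q \<in> OK" unfolding q_def by (intro OK_intros yOK)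
  have dOK: "d \<in> OK" by (simp add: d_def)
  have pOK: "p \<in> OK" unfolding p_def by (intro OK_tower dOK qOK)
  have sOK: "s \<in> OK" unfolding s_def by (intro OK_digits OK_intros qOK OK_numeral z)
  have VOK: "V \<in> OK" unfolding V_def by (intro OK_intros sOK ukj yOK pOK)
  have A1OK: "A1 \<in> OK" unfolding A1_def by (intro OK_intros dOK qOK OK_numeral)
  have A2OK: "A2 \<in> OK" unfolding A2_def by (intro OK_intros OK_tower dOK qOK VOK OK_numeral)
  have TOK: "T \<in> OK" unfolding T_def by (intro OK_intros ukj OK_numeral)
  \<comment> \<open>A zero of \<open>T\<close> would put 1/2 or 1/3 into \<open>OK\<close>.\<close>
  have T0: "T \<noteq> 0"
    using half_not_OK[of k 0] third_not_OK[of k] ukj by (auto simp: T_def)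
  define a0 where "a0 = csqrt A1"
  define b0 where "b0 = csqrt A2"
  have sq: "a0\<^sup>2 = A1" "b0\<^sup>2 = A2" by (simp_all add: a0_def b0_def)
  have "(X - y * (a0 + 2 * b0)) * (X - y * (a0 - 2 * b0)) * (X + y * (a0 + 2 * b0)) * (X + y * (a0 - 2 * b0)) = 0"
    using root unfolding core_poly_factorization[OF sq q_def, symmetric]
    unfolding core_poly_def Let_def A1_def A2_def X_def T_def V_def s_def p_def q_def y_def y'_def d_def
    by (simp add: mult.assoc)
  then consider "X = y * (a0 + 2 * b0)" | "X = y * (a0 + 2 * (- b0))"
    | "X = y * (- a0 + 2 * (- b0))" | "X = y * (- a0 + 2 * b0)"
    unfolding mult_eq_0_iff by (auto simp: algebra_simps add_eq_0_iff2)
  \<comment> \<open>The signs are absorbed into the choice of the square roots.\<close>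
  then obtain a b where ab: "a\<^sup>2 = A1" "b\<^sup>2 = A2" "X = y * (a + 2 * b)"
    using sq by cases (metis power2_minus)+
  \<comment> \<open>For y = 0 also \<open>X\<close> would vanish, and with it
    \<open>T\<close>.\<close>
  have y0: "y \<noteq> 0" using ab(3) T0 by (auto simp: X_def)
  have N0: "N \<noteq> 0" using y0 by (auto simp: y_def y'_def)
  have "a + 2 * b = j - T / y" using ab(3) y0 by (simp add: X_def field_simps)
  then have sumK: "a + 2 * b \<in> K" using ukj TOK yOK by (simp add: K_diff K_divide OK_in_K)
  \<comment> \<open>\<open>A1\<close> is 1 plus a multiple of 4, so equality would make 2 a unit of
    \<open>OK\<close>. This is where the weight 2 of the second root matters.\<close>
  have "A1 \<noteq> 4 * A2"
  proof
    assume "A1 = 4 * A2"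
    then have "2 * (2 * A2 - d * (2 * (y' * y'))) = of_int (2 * 0 + 1)"
      by (simp add: A1_def q_def y_def algebra_simps)
    moreover have "2 * A2 - d * (2 * (y' * y')) \<in> OK"
      by (intro OK_diff OK_mult OK_numeral dOK y'OK A2OK)
    ultimately show False using half_not_OK by blast
  qed
  then have abOK: "a \<in> OK" "b \<in> OK" using sqrt_sum_OK[of a b] ab A1OK A2OK sumK by simp_all
  have pell1: "a\<^sup>2 = of_int pell_d * (2 * y')\<^sup>2 + 1"
    unfolding ab A1_def q_def y_def d_def by (simp add: power2_eq_square)
  obtain xi where xi: "a = of_int xi" using pell_solutions_Ints(1)[OF abOK(1) y'OK pell1] by (auto elim: Ints_cases)
  obtain yi where yi: "y = of_int yi"
    using pell_solutions_Ints(2)[OF abOK(1) y'OK pell1] by (auto elim: Ints_cases simp: y_def)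
  have yi0: "yi \<noteq> 0" using y0 yi by auto
  define qi where "qi = yi * yi"
  have qi: "q = of_int qi" by (simp add: q_def yi qi_def)
  have dp: "pell_d \<ge> 1" using D_nonzero by (simp add: pell_d_def)
  have qi1: "qi \<ge> 1" using yi0 unfolding qi_def by (metis not_le zero_less_mult_iff int_one_le_iff_zero_less linorder_neq_iff)
  define pv where "pv = tower pell_d qi n"
  have pv: "p = of_int pv" by (simp add: p_def pv_def of_int_tower qi d_def)
  have "(of_int xi :: complex)\<^sup>2 = of_int (pell_d * yi\<^sup>2 + 1)"
    using pell1 unfolding y_def[symmetric] yi xi by simp
  then have "xi\<^sup>2 = pell_d * yi\<^sup>2 + 1" by (simp only: of_int_power[symmetric] of_int_eq_iff)
  then obtain g where g: "tower pell_d qi (Suc n) = pell_d * (2 * g)\<^sup>2"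
    using tower_square unfolding qi_def by blast
  have "tower pell_d qi (Suc n) \<ge> 1" using tower_ge_1[OF dp, of qi "Suc n"] qi1 by (simp del: tower.simps)
  then have g0: "g \<noteq> 0" unfolding g by auto
  have "tower d q (Suc n) = of_int (tower pell_d qi (Suc n))"
    by (simp only: of_int_tower qi d_def)
  then have "b\<^sup>2 = of_int (yi * yi) * of_int (pell_d * (2 * g)\<^sup>2) * (V * V) + 1"
    unfolding ab A2_def g by (simp only: qi qi_def)
  \<comment> \<open>\<open>A2\<close> has again the Pell form 1 + d (2 w)^2, now with w = y g V; so
    \<open>V\<close> is rational.\<close>
  then have "b\<^sup>2 = of_int pell_d * (2 * (of_int (yi * g) * V))\<^sup>2 + 1"
    by (simp add: power2_eq_square mult_ac)
  then have "2 * (of_int (yi * g) * V) \<in> \<int>"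
    using pell_solutions_Ints(2) abOK(2) VOK OK_of_int OK_mult by blast
  then obtain m where "2 * (of_int (yi * g) * V) = of_int m" by (elim Ints_cases)
  then have "of_int (2 * (yi * g)) * V = of_int m" by (simp add: mult.assoc)
  then have "V \<in> \<int>" by (rule OK_rat_int[OF VOK]) (use yi0 g0 in simp)
  then obtain vi where vi: "V = of_int vi" by (elim Ints_cases)
  define t where "t = (\<lambda>i. irr (z i))"
  \<comment> \<open>In V = s + k y p the numbers \<open>V\<close>, \<open>y\<close> and
    \<open>p\<close> are integers. Taking irrational parts shows that \<open>p\<close> divides the
    number with digits \<open>irr (z i)\<close>.\<close>
  have "0 = irr (s + of_int (yi * pv) * k)" using vi by (simp add: V_def yi pv mult_ac)
  also have "\<dots> = irr s + yi * pv * irr k"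
    using sOK ukj by (simp add: irr_add irr_mult_int OK_mult del: of_int_mult)
  also have "irr s = digits (4 * qi) t n"
    using irr_digits[of n z "4 * qi"] z by (simp add: s_def t_def qi)
  finally have "digits (4 * qi) t n = pv * (- yi * irr k)" by (simp add: algebra_simps)
  then have pdvd: "pv dvd digits (4 * qi) t n" by (metis dvd_triv_left)
  \<comment> \<open>Each 1 + 2 (z i)^2 divides \<open>y\<close> in \<open>OK\<close>, so
    \<open>irr_bound\<close> gives at most 2 |y|, which is less than the base 4 y^2.\<close>
  have tb: "\<bar>t i\<bar> < 4 * qi" if "i < n" for i
  proof -
    have "\<exists>e\<in>OK. bound_prod z n = (1 + 2 * (z i * z i)) * e"
      using that z
    proof (induction n)
      case (Suc n)
      show ?case
      proof (cases "i = n")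
        case True
        then show ?thesis using Suc.prems by (auto intro!: bexI[of _ "bound_prod z n"] OK_bound_prod)
      next
        case False
        then obtain e where e: "e \<in> OK" "bound_prod z n = (1 + 2 * (z i * z i)) * e"
          using Suc by auto
        have "e * (1 + 2 * (z n * z n)) \<in> OK" using e Suc.prems(2)[of n] by (intro OK_intros OK_numeral) auto
        then show ?thesis using e(2) by (intro bexI[of _ "e * (1 + 2 * (z n * z n))"]) (simp_all add: mult_ac)
      qed
    qed simp
    then obtain e where e: "e \<in> OK" "bound_prod z n = (1 + 2 * (z i * z i)) * e" by blast
    have "of_int yi = (1 + 2 * (z i)\<^sup>2) * (2 * N * e * u)"
      unfolding yi[symmetric] y_def y'_def e(2) by (simp add: power2_eq_square mult_ac)
    moreover have "2 * N * e * u \<in> OK" by (intro OK_intros OK_numeral N e ukj)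
    ultimately have "\<bar>t i\<bar> \<le> 2 * \<bar>yi\<bar>"
      unfolding t_def using irr_bound[OF z[OF that]] yi0 by blast
    moreover have "\<bar>yi\<bar> * 1 \<le> \<bar>yi\<bar> * \<bar>yi\<bar>" using yi0 by (intro mult_left_mono) auto
    then have "\<bar>yi\<bar> \<le> qi" by (simp add: qi_def)
    ultimately show ?thesis using qi1 by linarith
  qed
  \<comment> \<open>A multiple of \<open>pv\<close> that is smaller than \<open>pv\<close> in
    absolute value is 0.\<close>
  have "\<bar>digits (4 * qi) t n\<bar> \<le> (4 * qi) ^ n - 1"
    using tb qi1 by (intro digits_bound) force+
  also have "\<dots> < pv" unfolding pv_def using tower_ge_power[OF dp, of qi n] qi1 by simp
  finally have "digits (4 * qi) t n = 0" using pdvd zdvd_not_zless[of "\<bar>digits (4 * qi) t n\<bar>" pv] by force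
  then have "t i = 0" if "i < n" for i using digits_eq_0[of n t "4 * qi" i] tb that by blast
  then show ?thesis using N0 z by (auto simp: t_def intro: irr_eq_0_Ints)
qed

end

section \<open>Evaluation of polynomials\<close>

definition eval_monom :: "(nat \<Rightarrow>\<^sub>0 nat) \<Rightarrow> complex list \<Rightarrow> complex" where
  "eval_monom e xs = (\<Prod>i\<in>Poly_Mapping.keys e. (xs ! i) ^ Poly_Mapping.lookup e i)"

lemma eval_monom_superset:
  "finite A \<Longrightarrow> Poly_Mapping.keys e \<subseteq> A \<Longrightarrow> eval_monom e xs = (\<Prod>i\<in>A. (xs ! i) ^ Poly_Mapping.lookup e i)"
  unfolding eval_monom_def by (rule prod.mono_neutral_left) (auto simp: in_keys_iff)

lemma eval_monom_add: "eval_monom (e + e') xs = eval_monom e xs * eval_monom e' xs"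
proof -
  let ?A = "Poly_Mapping.keys e \<union> Poly_Mapping.keys e'"
  have "eval_monom (e + e') xs = (\<Prod>i\<in>?A. (xs ! i) ^ Poly_Mapping.lookup (e + e') i)"
    using Poly_Mapping.keys_add[of e e'] by (intro eval_monom_superset) auto
  also have "\<dots> = eval_monom e xs * eval_monom e' xs"
    by (simp add: eval_monom_superset[of ?A] lookup_add power_add prod.distrib)
  finally show ?thesis .
qed

text \<open>Provides one index set for two polynomials and their sum, in which terms may
  cancel.\<close>

lemma eval_mpoly_superset:
  "finite A \<Longrightarrow> Poly_Mapping.keys p \<subseteq> A \<Longrightarrow>
    eval_mpoly p xs = (\<Sum>e\<in>A. of_int (Poly_Mapping.lookup p e) * eval_monom e xs)"
  unfolding eval_mpoly_def eval_monom_def by (rule sum.mono_neutral_left) (auto simp: in_keys_iff)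

lemma eval_mpoly_add: "eval_mpoly (p + q) xs = eval_mpoly p xs + eval_mpoly q xs"
proof -
  let ?A = "Poly_Mapping.keys p \<union> Poly_Mapping.keys q"
  have "eval_mpoly (p + q) xs = (\<Sum>e\<in>?A. of_int (Poly_Mapping.lookup (p + q) e) * eval_monom e xs)"
    using Poly_Mapping.keys_add[of p q] by (intro eval_mpoly_superset) auto
  also have "\<dots> = eval_mpoly p xs + eval_mpoly q xs"
    by (simp add: eval_mpoly_superset[of ?A] lookup_add distrib_right sum.distrib)
  finally show ?thesis .
qed

lemma eval_mpoly_single: "eval_mpoly (Poly_Mapping.single e c) xs = of_int c * eval_monom e xs"
  by (simp add: eval_mpoly_superset[of "{e}"])

lemma mpoly_of_int_eq: "(of_int c :: int_mpoly) = Poly_Mapping.single 0 c"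
  using single_of_int[of c, where 'b = int, symmetric] by (simp only: of_int_eq_id id_apply)

lemma eval_mpoly_of_int [simp]: "eval_mpoly (of_int c) xs = of_int c"
  unfolding mpoly_of_int_eq eval_mpoly_single by (simp add: eval_monom_def)

lemma eval_mpoly_numeral [simp]: "eval_mpoly (numeral k) xs = numeral k"
  "eval_mpoly 1 xs = 1" "eval_mpoly 0 xs = 0"
  using eval_mpoly_of_int[of "numeral k" xs] eval_mpoly_of_int[of 1 xs] eval_mpoly_of_int[of 0 xs]
  by simp_all

lemma poly_mapping_sum_single:
  fixes p :: "'a \<Rightarrow>\<^sub>0 'b::comm_monoid_add"
  shows
  "(\<Sum>e\<in>Poly_Mapping.keys p. Poly_Mapping.single e (Poly_Mapping.lookup p e)) = p"
  by (rule poly_mapping_eqI)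
    (simp add: lookup_sum lookup_single when_def in_keys_iff)

lemma poly_mapping_add_induct:
  fixes p :: "'a \<Rightarrow>\<^sub>0 'b::comm_monoid_add"
  assumes "\<And>e c. P (Poly_Mapping.single e c)" "\<And>p q. P p \<Longrightarrow> P q \<Longrightarrow> P (p + q)"
  shows "P p"
proof -
  have "P (\<Sum>e\<in>A. Poly_Mapping.single e (Poly_Mapping.lookup p e))" if "finite A" for A
    \<comment> \<open>The empty sum is a single term with coefficient 0, at an arbitrary
      place.\<close>
    using that assms(1)[of undefined 0] by induction (auto intro: assms)
  from this[of "Poly_Mapping.keys p"] show ?thesis by (simp add: poly_mapping_sum_single)
qed

text \<open>Both sides are additive in each factor, so it suffices to compare single terms.\<close>

lemma eval_mpoly_mult: "eval_mpoly (p * q) xs = eval_mpoly p xs * eval_mpoly q xs"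
proof (induction p rule: poly_mapping_add_induct)
  case (1 e c)
  show ?case
    by (induction q rule: poly_mapping_add_induct)
      (simp_all add: mult_single eval_mpoly_single eval_monom_add distrib_left eval_mpoly_add)
next
  case (2 p p')
  then show ?case by (simp add: distrib_right eval_mpoly_add)
qed

lemma eval_mpoly_minus: "eval_mpoly (p - q) xs = eval_mpoly p xs - eval_mpoly q xs"
  using eval_mpoly_add[of "p - q" q xs] by simp

lemmas eval_mpoly_hom = eval_mpoly_add eval_mpoly_mult eval_mpoly_minus

lemma eval_mpoly_sum: "eval_mpoly (sum f A) xs = (\<Sum>i\<in>A. eval_mpoly (f i) xs)"
  by (induction A rule: infinite_finite_induct) (auto simp: eval_mpoly_add)

lemma eval_mpoly_prod: "eval_mpoly (prod f A) xs = (\<Prod>i\<in>A. eval_mpoly (f i) xs)"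
  by (induction A rule: infinite_finite_induct) (auto simp: eval_mpoly_mult)

section \<open>Polynomials in a given number of variables\<close>

definition mpoly_var :: "nat \<Rightarrow> int_mpoly" where
  "mpoly_var i = Poly_Mapping.single (Poly_Mapping.single i 1) 1"

lemma eval_mpoly_var [simp]: "eval_mpoly (mpoly_var i) xs = xs ! i"
  by (simp add: mpoly_var_def eval_mpoly_single eval_monom_def)

lemma int_polys_single:
  "Poly_Mapping.keys e \<subseteq> {..<n} \<Longrightarrow> Poly_Mapping.single e c \<in> int_polys n"
  by (simp add: int_polys_def)

lemma int_polys_var: "i < n \<Longrightarrow> mpoly_var i \<in> int_polys n"
  by (simp add: mpoly_var_def int_polys_single)

lemma int_polys_of_int: "of_int c \<in> int_polys n"
  unfolding mpoly_of_int_eq by (rule int_polys_single) simp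

lemma int_polys_numeral: "numeral k \<in> int_polys n" "1 \<in> int_polys n" "0 \<in> int_polys n"
  using int_polys_of_int[of "numeral k" n] int_polys_of_int[of 1 n] int_polys_of_int[of 0 n] by simp_all

lemma int_polys_add: "p \<in> int_polys n \<Longrightarrow> q \<in> int_polys n \<Longrightarrow> p + q \<in> int_polys n"
  using Poly_Mapping.keys_add[of p q] by (fastforce simp: int_polys_def)

lemma int_polys_mult:
  assumes "p \<in> int_polys n" "q \<in> int_polys n"
  shows "p * q \<in> int_polys n"
  unfolding int_polys_def
proof (intro CollectI ballI)
  fix e assume "e \<in> Poly_Mapping.keys (p * q)"
  then obtain a b where "a \<in> Poly_Mapping.keys p" "b \<in> Poly_Mapping.keys q" "e = a + b"
    using keys_mult[of p q] by blast
  then show "Poly_Mapping.keys e \<subseteq> {..<n}"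
    using assms Poly_Mapping.keys_add[of a b] unfolding int_polys_def by blast
qed

lemma int_polys_diff: "p \<in> int_polys n \<Longrightarrow> q \<in> int_polys n \<Longrightarrow> p - q \<in> int_polys n"
  using int_polys_add[of p n "of_int (-1) * q"] int_polys_mult[of "of_int (-1)" n q]
    int_polys_of_int[of "-1" n] by simp

lemma int_polys_mono: "p \<in> int_polys n \<Longrightarrow> n \<le> n' \<Longrightarrow> p \<in> int_polys n'"
  by (force simp: int_polys_def)

lemmas int_polys_intros = int_polys_add int_polys_mult int_polys_diff int_polys_numeral int_polys_of_int

lemma int_polys_sum: "(\<And>i. i \<in> A \<Longrightarrow> f i \<in> int_polys n) \<Longrightarrow> sum f A \<in> int_polys n"
  by (induction A rule: infinite_finite_induct) (auto intro: int_polys_intros)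

lemma int_polys_prod: "(\<And>i. i \<in> A \<Longrightarrow> f i \<in> int_polys n) \<Longrightarrow> prod f A \<in> int_polys n"
  by (induction A rule: infinite_finite_induct) (auto intro: int_polys_intros)

lemma eval_bound_prod: "eval_mpoly (bound_prod z n) xs = bound_prod (\<lambda>i. eval_mpoly (z i) xs) n"
  by (induction n) (auto simp: eval_mpoly_hom)

lemma eval_digits: "eval_mpoly (digits w z n) xs = digits (eval_mpoly w xs) (\<lambda>i. eval_mpoly (z i) xs) n"
  by (induction n) (auto simp: eval_mpoly_hom)

lemma eval_tower: "eval_mpoly (tower d q n) xs = tower (eval_mpoly d xs) (eval_mpoly q xs) n"
  by (induction n) (auto simp: eval_mpoly_hom)

lemma eval_core_poly:
  "eval_mpoly (core_poly d n z N u k j) xs =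
     core_poly (eval_mpoly d xs) n (\<lambda>i. eval_mpoly (z i) xs) (eval_mpoly N xs)
       (eval_mpoly u xs) (eval_mpoly k xs) (eval_mpoly j xs)"
  by (simp add: core_poly_def Let_def eval_mpoly_hom eval_bound_prod eval_digits eval_tower
      del: tower.simps)

lemma int_polys_bound_prod:
  "(\<And>i. i < n \<Longrightarrow> z i \<in> int_polys l) \<Longrightarrow> bound_prod z n \<in> int_polys l"
  by (induction n) (auto intro!: int_polys_intros)

lemma int_polys_digits:
  "w \<in> int_polys l \<Longrightarrow> (\<And>i. i < n \<Longrightarrow> z i \<in> int_polys l) \<Longrightarrow> digits w z n \<in> int_polys l"
  by (induction n) (auto intro!: int_polys_intros)

lemma int_polys_tower: "d \<in> int_polys l \<Longrightarrow> q \<in> int_polys l \<Longrightarrow> tower d q n \<in> int_polys l"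
  by (induction n) (auto intro!: int_polys_intros)

lemma int_polys_core_poly:
  assumes "d \<in> int_polys l" "\<And>i. i < n \<Longrightarrow> z i \<in> int_polys l" "N \<in> int_polys l"
    "u \<in> int_polys l" "k \<in> int_polys l" "j \<in> int_polys l"
  shows "core_poly d n z N u k j \<in> int_polys l"
  unfolding core_poly_def Let_def
  by (intro int_polys_intros int_polys_bound_prod int_polys_digits int_polys_tower assms)

section \<open>Recursive operations on codes\<close>

abbreviation cfst :: "nat \<Rightarrow> nat" where "cfst x \<equiv> fst (prod_decode x)"
abbreviation csnd :: "nat \<Rightarrow> nat" where "csnd x \<equiv> snd (prod_decode x)"

lemma rf_id: "recursive_fun (\<lambda>x. x)"
  using rec_pair[OF rec_fst rec_snd] by simp

lemma rf_const: "recursive_fun (\<lambda>x. c)"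
  by (induction c) (auto intro: rec_zero rec_comp[OF rec_Suc])

lemma rf_Suc: "recursive_fun f \<Longrightarrow> recursive_fun (\<lambda>x. Suc (f x))"
  by (rule rec_comp[OF rec_Suc])

lemma rf_fst: "recursive_fun f \<Longrightarrow> recursive_fun (\<lambda>x. cfst (f x))"
  by (rule rec_comp[OF rec_fst])

lemma rf_snd: "recursive_fun f \<Longrightarrow> recursive_fun (\<lambda>x. csnd (f x))"
  by (rule rec_comp[OF rec_snd])

text \<open>The step may depend on \<open>x\<close>, because \<open>rec_prim\<close> is applied with
  the whole argument as its parameter.\<close>

lemma rf_rec_nat:
  assumes "recursive_fun b" "recursive_fun (\<lambda>w. s (cfst w) (cfst (csnd w)) (csnd (csnd w)))" "recursive_fun n"
  shows "recursive_fun (\<lambda>x. rec_nat (b x) (s x) (n x))"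
  using rec_comp[OF rec_prim[OF assms(1,2)] rec_pair[OF rf_id assms(3)]] by simp

lemmas rf_intros = rec_pair rf_id rf_const rf_Suc rf_fst rf_snd

lemma rf_add:
  assumes "recursive_fun f" "recursive_fun g"
  shows "recursive_fun (\<lambda>x. f x + g x)"
proof -
  have "rec_nat a (\<lambda>k y. Suc y) b = a + b" for a b :: nat by (induction b) auto
  then show ?thesis using rf_rec_nat[of f "\<lambda>x k y. Suc y" g] assms by (simp add: rf_intros)
qed

lemma rf_mult:
  assumes f: "recursive_fun f" and g: "recursive_fun g"
  shows "recursive_fun (\<lambda>x. f x * g x)"
proof -
  have "rec_nat 0 (\<lambda>k y. a + y) b = a * b" for a b :: nat by (induction b) auto
  moreover have "recursive_fun (\<lambda>x. rec_nat 0 (\<lambda>k y. f x + y) (g x))"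
    by (intro rf_rec_nat rf_add rf_intros rec_comp[OF f] g)
  ultimately show ?thesis by simp
qed

lemma rf_pred: "recursive_fun f \<Longrightarrow> recursive_fun (\<lambda>x. f x - 1)"
proof -
  assume f: "recursive_fun f"
  have "rec_nat 0 (\<lambda>k y. k) b = b - 1" for b :: nat by (cases b) auto
  moreover have "recursive_fun (\<lambda>x. rec_nat 0 (\<lambda>k y. k) (f x))"
    by (intro rf_rec_nat rf_intros f)
  ultimately show ?thesis by simp
qed

lemma rf_diff:
  assumes f: "recursive_fun f" and g: "recursive_fun g"
  shows "recursive_fun (\<lambda>x. f x - g x)"
proof -
  have "rec_nat a (\<lambda>k y. y - 1) b = a - b" for a b :: nat by (induction b) auto
  moreover have "recursive_fun (\<lambda>x. rec_nat (f x) (\<lambda>k y. y - 1) (g x))"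
    by (intro rf_rec_nat rf_pred rf_intros f g)
  ultimately show ?thesis by simp
qed

lemma rf_if_zero:
  assumes c: "recursive_fun c" and f: "recursive_fun f" and g: "recursive_fun g"
  shows "recursive_fun (\<lambda>x. if c x = 0 then f x else g x)"
proof -
  have "rec_nat a (\<lambda>k y. b) n = (if n = 0 then a else b)" for a b n :: nat by (cases n) auto
  moreover have "recursive_fun (\<lambda>x. rec_nat (f x) (\<lambda>k y. g x) (c x))"
    by (intro rf_rec_nat rf_intros f rec_comp[OF g] c)
  ultimately show ?thesis by simp
qed

lemma rf_mod2:
  assumes f: "recursive_fun f"
  shows "recursive_fun (\<lambda>x. f x mod 2)"
proof -
  have "rec_nat 0 (\<lambda>k y. 1 - y) n = n mod 2" for n :: nat
    by (induction n) (simp_all, presburger)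
  moreover have "recursive_fun (\<lambda>x. rec_nat 0 (\<lambda>k y. 1 - y) (f x))"
    by (intro rf_rec_nat rf_diff rf_intros f)
  ultimately show ?thesis by simp
qed

lemma rf_div2:
  assumes f: "recursive_fun f"
  shows "recursive_fun (\<lambda>x. f x div 2)"
proof -
  have "rec_nat 0 (\<lambda>k y. y + k mod 2) n = n div 2" for n :: nat
    by (induction n) (simp_all, presburger)
  moreover have "recursive_fun (\<lambda>x. rec_nat 0 (\<lambda>k y. y + k mod 2) (f x))"
    by (intro rf_rec_nat rf_add rf_mod2 rf_intros f)
  ultimately show ?thesis by simp
qed

lemmas rf_arith = rf_add rf_mult rf_diff rf_if_zero rf_mod2 rf_div2

definition ccons :: "nat \<Rightarrow> nat \<Rightarrow> nat" where
  "ccons a b = Suc (prod_encode (a, b))"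

text \<open>Iterated tails, then the head. Past the end the value is 0, since 0 - 1 = 0 and
  \<open>prod_decode 0 = (0, 0)\<close>; this default fits zero exponents and zero terms.\<close>

definition cnth :: "nat \<Rightarrow> nat \<Rightarrow> nat" where
  "cnth c i = cfst (rec_nat c (\<lambda>_ y. csnd (y - 1)) i - 1)"

lemma list_decode_ccons [simp]: "list_decode (ccons a b) = a # list_decode b"
  by (simp add: ccons_def)

lemma cnth_list_decode: "cnth c i = (if i < length (list_decode c) then list_decode c ! i else 0)"
proof -
  have pd0: "prod_decode 0 = (0, 0)"
    using prod_encode_inverse[of "(0, 0)"] by (simp add: prod_encode_def)
  have tl: "list_decode (csnd (y - 1)) = tl (list_decode y)" for y
    by (cases y) (simp_all add: pd0 split: prod.split)
  have hd: "cfst (y - 1) = (if list_decode y = [] then 0 else hd (list_decode y))" for y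
    by (cases y) (simp_all add: pd0 split: prod.split)
  have "list_decode (rec_nat c (\<lambda>_ y. csnd (y - 1)) i) = drop i (list_decode c)"
    by (induction i) (simp_all add: tl[unfolded One_nat_def] drop_Suc tl_drop)
  then show ?thesis unfolding cnth_def hd by (simp add: hd_drop_conv_nth)
qed

lemma cnth_list_encode: "i < length xs \<Longrightarrow> cnth (list_encode xs) i = xs ! i"
  by (simp add: cnth_list_decode)

lemma rf_cnth:
  assumes f: "recursive_fun f" and g: "recursive_fun g"
  shows "recursive_fun (\<lambda>x. cnth (f x) (g x))"
  unfolding cnth_def by (intro rf_fst rf_pred rf_rec_nat rf_intros f g)

lemma rf_ccons:
  assumes f: "recursive_fun f" and g: "recursive_fun g"
  shows "recursive_fun (\<lambda>x. ccons (f x) (g x))"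
  unfolding ccons_def by (intro rf_intros f g)

text \<open>Lets the code itself serve as the bound of every loop over the list.\<close>

lemma length_list_decode: "length (list_decode c) \<le> c"
proof (induction c rule: list_decode.induct)
  case (2 n)
  obtain x y where xy: "prod_decode n = (x, y)" by fastforce
  have "y \<le> n" using le_prod_encode_2[of y x] xy by (metis prod_decode_inverse)
  with 2[OF xy[symmetric]] xy show ?case by simp
qed simp

lemma lookup_decode_monom: "Poly_Mapping.lookup (decode_monom e) i = cnth e i"
  by (simp add: decode_monom_def nth.rep_eq nth_default_def cnth_list_decode)

text \<open>Adds exponent lists. The result is built from its last entry backwards and has length
  \<open>e + f\<close>, enough for both lists; trailing zeros do not change the monomial.\<close>

definition cmonom_mult :: "nat \<Rightarrow> nat \<Rightarrow> nat" where
  "cmonom_mult e f =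
     rec_nat 0 (\<lambda>k y. ccons (cnth e (e + f - 1 - k) + cnth f (e + f - 1 - k)) y) (e + f)"

lemma decode_monom_mult: "decode_monom (cmonom_mult e f) = decode_monom e + decode_monom f"
proof -
  define g where "g = (\<lambda>i. cnth e i + cnth f i)"
  define n where "n = e + f"
  \<comment> \<open>After \<open>m\<close> rounds the list consists of the last \<open>m\<close>
    entries.\<close>
  have "list_decode (rec_nat 0 (\<lambda>k y. ccons (g (n - 1 - k)) y) m) = map g [n - m..<n]" if "m \<le> n" for m
    using that
  proof (induction m)
    case (Suc m)
    then have "[n - Suc m..<n] = (n - 1 - m) # [n - m..<n]"
      by (subst upt_conv_Cons) (auto simp: Suc_diff_Suc)
    with Suc show ?case by simp
  qed simp
  from this[of n] have l: "list_decode (cmonom_mult e f) = map g [0..<n]"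
    by (simp add: cmonom_mult_def n_def g_def)
  show ?thesis
  proof (rule poly_mapping_eqI)
    fix i
    have "cnth (cmonom_mult e f) i = g i"
      using length_list_decode[of e] length_list_decode[of f]
      by (simp add: cnth_list_decode l) (auto simp: g_def n_def cnth_list_decode)
    then show "Poly_Mapping.lookup (decode_monom (cmonom_mult e f)) i =
        Poly_Mapping.lookup (decode_monom e + decode_monom f) i"
      by (simp add: lookup_decode_monom lookup_add g_def)
  qed
qed

lemma rf_cmonom_mult:
  assumes f: "recursive_fun f" and g: "recursive_fun g"
  shows "recursive_fun (\<lambda>x. cmonom_mult (f x) (g x))"
  unfolding cmonom_mult_def
  by (intro rf_rec_nat rf_ccons rf_cnth rf_arith rf_intros f g rec_comp[OF f] rec_comp[OF g])

text \<open>The integer coded by \<open>a\<close> has absolute value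
  \<open>a div 2 + a mod 2\<close> and is negative for odd \<open>a\<close>. A number n is coded by
  2 n and -n by 2 n - 1; for n = 0 truncated subtraction gives 0 in both cases.\<close>

definition cint_mult :: "nat \<Rightarrow> nat \<Rightarrow> nat" where
  "cint_mult a b = 2 * ((a div 2 + a mod 2) * (b div 2 + b mod 2)) - (a mod 2 + b mod 2) mod 2"

lemma int_decode_even_odd: "int_decode (2 * n) = int n" "int_decode (Suc (2 * n)) = - int n - 1"
  by (simp_all add: int_decode_def sum_decode_def)

lemma int_decode_sign_abs:
  "int_decode a = (if a mod 2 = 0 then int (a div 2 + a mod 2) else - int (a div 2 + a mod 2))"
proof -
  have "a = 2 * (a div 2) \<and> a mod 2 = 0 \<or> a = Suc (2 * (a div 2)) \<and> a mod 2 = 1" by presburger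
  then show ?thesis using int_decode_even_odd[of "a div 2"] by auto
qed

lemma int_decode_double_diff: "int_decode (2 * n - s mod 2) = (if s mod 2 = 0 then int n else - int n)"
proof (cases n)
  case 0
  then show ?thesis using int_decode_even_odd(1)[of 0] by simp
next
  case (Suc m)
  have "s mod 2 = 0 \<or> s mod 2 = 1" by presburger
  then show ?thesis using Suc int_decode_even_odd(1)[of n] int_decode_even_odd(2)[of m] by auto
qed

lemma int_decode_mult: "int_decode (cint_mult a b) = int_decode a * int_decode b"
proof -
  have "a mod 2 = 0 \<or> a mod 2 = 1" "b mod 2 = 0 \<or> b mod 2 = 1" by presburger+
  then show ?thesis
    unfolding cint_mult_def int_decode_double_diff int_decode_sign_abs[of a] int_decode_sign_abs[of b]
    by (elim disjE) (simp_all add: algebra_simps)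
qed

lemma rf_cint_mult:
  assumes f: "recursive_fun f" and g: "recursive_fun g"
  shows "recursive_fun (\<lambda>x. cint_mult (f x) (g x))"
  unfolding cint_mult_def by (intro rf_arith rf_intros f g)

section \<open>Computable families of polynomials\<close>

definition decode_term :: "nat \<Rightarrow> int_mpoly" where
  "decode_term t = Poly_Mapping.single (decode_monom (cfst t)) (int_decode (csnd t))"

lemma decode_mpoly_sum_list: "decode_mpoly c = (\<Sum>t\<leftarrow>list_decode c. decode_term t)"
  unfolding decode_mpoly_def decode_term_def by (simp add: case_prod_beta)

lemma decode_mpoly_ccons: "decode_mpoly (ccons t c) = decode_term t + decode_mpoly c"
  by (simp add: decode_mpoly_sum_list)

lemma decode_mpoly_0: "decode_mpoly 0 = 0"
  by (simp add: decode_mpoly_sum_list)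

lemma decode_term_0: "decode_term 0 = 0"
  using prod_encode_inverse[of "(0, 0)"] int_decode_even_odd(1)[of 0]
  by (simp add: decode_term_def prod_encode_def)

text \<open>The summation may run beyond the end of the list, since the padding \<open>0\<close> codes the zero term.\<close>

lemma decode_mpoly_sum: "decode_mpoly c = (\<Sum>i<c. decode_term (cnth c i))"
proof -
  have "decode_mpoly c = (\<Sum>i<length (list_decode c). decode_term (cnth c i))"
    by (simp add: decode_mpoly_sum_list sum_list_sum_nth atLeast0LessThan cnth_list_decode)
  also have "\<dots> = (\<Sum>i<c. decode_term (cnth c i))"
    using length_list_decode[of c]
    by (intro sum.mono_neutral_left) (auto simp: cnth_list_decode decode_term_0)
  finally show ?thesis .
qed

text \<open>The computed code may be any preimage under \<open>decode_mpoly\<close>, so equal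
  monomials never have to be collected or sorted.\<close>

definition poly_recursive :: "(nat \<Rightarrow> int_mpoly) \<Rightarrow> bool" where
  "poly_recursive G \<longleftrightarrow> (\<exists>F. recursive_fun F \<and> (\<forall>x. decode_mpoly (F x) = G x))"

lemma poly_recursive_decode: "recursive_fun f \<Longrightarrow> poly_recursive (\<lambda>x. decode_mpoly (f x))"
  unfolding poly_recursive_def by blast

lemma poly_recursive_comp:
  assumes "poly_recursive G" "recursive_fun f"
  shows "poly_recursive (\<lambda>x. G (f x))"
  using assms rec_comp unfolding poly_recursive_def by metis

text \<open>The terms of the first list are put in front of the second; running beyond its end only
  adds zero terms.\<close>

lemma poly_recursive_add:
  assumes "poly_recursive G" "poly_recursive H"
  shows "poly_recursive (\<lambda>x. G x + H x)"
proof -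
  obtain f g where f: "recursive_fun f" "\<And>x. decode_mpoly (f x) = G x"
    and g: "recursive_fun g" "\<And>x. decode_mpoly (g x) = H x"
    using assms unfolding poly_recursive_def by metis
  define F where "F = (\<lambda>x. rec_nat (g x) (\<lambda>i y. ccons (cnth (f x) i) y) (f x))"
  have "decode_mpoly (rec_nat b (\<lambda>i y. ccons (cnth a i) y) n) = (\<Sum>i<n. decode_term (cnth a i)) + decode_mpoly b" for a b n
    by (induction n) (simp_all add: decode_mpoly_ccons ac_simps)
  then have "decode_mpoly (F x) = G x + H x" for x
    unfolding F_def by (simp add: f(2) g(2) flip: decode_mpoly_sum)
  moreover have "recursive_fun F"
    unfolding F_def by (intro rf_rec_nat rf_ccons rf_cnth rf_intros f(1) g(1) rec_comp[OF f(1)])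
  ultimately show ?thesis unfolding poly_recursive_def by blast
qed

text \<open>The recursion runs on codes. Its result is well determined as a polynomial because the
  step depends on the code only through the decoded value.\<close>

lemma poly_recursive_rec_nat:
  assumes "poly_recursive b"
    "poly_recursive (\<lambda>w. s (cfst w) (cfst (csnd w)) (decode_mpoly (csnd (csnd w))))" "recursive_fun n"
  shows "poly_recursive (\<lambda>x. rec_nat (b x) (s x) (n x))"
proof -
  obtain f g where f: "recursive_fun f" "\<And>x. decode_mpoly (f x) = b x"
    and g: "recursive_fun g" "\<And>w. decode_mpoly (g w) = s (cfst w) (cfst (csnd w)) (decode_mpoly (csnd (csnd w)))"
    using assms(1,2) unfolding poly_recursive_def by metis
  define F where "F = (\<lambda>x. rec_nat (f x) (\<lambda>k y. g (prod_encode (x, prod_encode (k, y)))) (n x))"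
  have "decode_mpoly (rec_nat (f x) (\<lambda>k y. g (prod_encode (x, prod_encode (k, y)))) m) = rec_nat (b x) (s x) m" for x m
    by (induction m) (simp_all add: f g)
  then have "decode_mpoly (F x) = rec_nat (b x) (s x) (n x)" for x by (simp add: F_def)
  moreover have "recursive_fun F"
    unfolding F_def by (rule rf_rec_nat) (simp_all add: f g assms)
  ultimately show ?thesis unfolding poly_recursive_def by blast
qed

lemma poly_recursive_sum:
  assumes "poly_recursive (\<lambda>w. G (cfst w) (csnd w))" "recursive_fun n"
  shows "poly_recursive (\<lambda>x. \<Sum>i<n x. G x i)"
proof -
  have "rec_nat 0 (\<lambda>k y. y + G x k) m = (\<Sum>i<m. G x i)" for x m
    by (induction m) auto
  moreover have "poly_recursive (\<lambda>x. rec_nat 0 (\<lambda>k y. y + G x k) (n x))"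
  proof (rule poly_recursive_rec_nat[OF _ _ assms(2)])
    show "poly_recursive (\<lambda>x. 0)"
      using poly_recursive_decode[OF rf_const[of 0]] by (simp add: decode_mpoly_0)
    have "poly_recursive (\<lambda>w. G (cfst w) (cfst (csnd w)))"
      using poly_recursive_comp[OF assms(1), of "\<lambda>w. prod_encode (cfst w, cfst (csnd w))"]
      by (simp add: rf_intros)
    then show "poly_recursive (\<lambda>w. decode_mpoly (csnd (csnd w)) + G (cfst w) (cfst (csnd w)))"
      by (intro poly_recursive_add poly_recursive_decode rf_intros)
  qed
  ultimately show ?thesis by simp
qed

lemma poly_recursive_single:
  assumes "recursive_fun e" "recursive_fun k"
  shows "poly_recursive (\<lambda>x. Poly_Mapping.single (decode_monom (e x)) (int_decode (k x)))"
proof -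
  have "decode_mpoly (ccons (prod_encode (e x, k x)) 0) =
      Poly_Mapping.single (decode_monom (e x)) (int_decode (k x))" for x
    by (simp add: decode_mpoly_ccons decode_mpoly_0 decode_term_def)
  moreover have "recursive_fun (\<lambda>x. ccons (prod_encode (e x, k x)) 0)"
    by (intro rf_ccons rf_intros assms)
  ultimately show ?thesis unfolding poly_recursive_def by blast
qed

text \<open>The product is expanded into one term for each pair of list positions.\<close>

lemma poly_recursive_mult:
  assumes "poly_recursive G" "poly_recursive H"
  shows "poly_recursive (\<lambda>x. G x * H x)"
proof -
  obtain f g where f: "recursive_fun f" "\<And>x. decode_mpoly (f x) = G x"
    and g: "recursive_fun g" "\<And>x. decode_mpoly (g x) = H x"
    using assms unfolding poly_recursive_def by metis
  have "decode_term s * decode_term t = Poly_Mapping.single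
      (decode_monom (cmonom_mult (cfst s) (cfst t))) (int_decode (cint_mult (csnd s) (csnd t)))" for s t
    by (simp add: decode_term_def mult_single decode_monom_mult int_decode_mult)
  then have eq: "G x * H x = (\<Sum>i<f x. \<Sum>j<g x. Poly_Mapping.single
      (decode_monom (cmonom_mult (cfst (cnth (f x) i)) (cfst (cnth (g x) j))))
      (int_decode (cint_mult (csnd (cnth (f x) i)) (csnd (cnth (g x) j)))))" for x
    unfolding f(2)[symmetric] g(2)[symmetric] decode_mpoly_sum[of "f x"] decode_mpoly_sum[of "g x"]
    by (simp add: sum_product)
  show ?thesis unfolding eq
    by (intro poly_recursive_sum poly_recursive_single rf_cmonom_mult rf_cint_mult rf_cnth rf_intros
        f(1) rec_comp[OF f(1)] rec_comp[OF g(1)])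
qed

lemma poly_recursive_int_decode: "recursive_fun k \<Longrightarrow> poly_recursive (\<lambda>x. of_int (int_decode (k x)))"
proof -
  assume k: "recursive_fun k"
  have "decode_monom 0 = 0" by (simp add: decode_monom_def)
  then show ?thesis unfolding mpoly_of_int_eq using poly_recursive_single[OF rf_const[of 0] k] by simp
qed

lemma poly_recursive_of_int: "poly_recursive (\<lambda>x. of_int c)"
  using poly_recursive_int_decode[OF rf_const[of "int_encode c"]] by simp

lemma poly_recursive_numeral: "poly_recursive (\<lambda>x. numeral c)" "poly_recursive (\<lambda>x. 1)" "poly_recursive (\<lambda>x. 0)"
  using poly_recursive_of_int[of "numeral c"] poly_recursive_of_int[of 1] poly_recursive_of_int[of 0] by simp_all

lemma poly_recursive_diff:
  assumes "poly_recursive G" "poly_recursive H"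
  shows "poly_recursive (\<lambda>x. G x - H x)"
  using poly_recursive_add[OF assms(1) poly_recursive_mult[OF poly_recursive_of_int[of "-1"] assms(2)]] by simp

lemma poly_recursive_var:
  assumes f: "recursive_fun f"
  shows "poly_recursive (\<lambda>x. mpoly_var (f x))"
proof -
  \<comment> \<open>The code of the exponent list with \<open>i\<close> zeros followed by 1; the
    coefficient 1 has the code 2.\<close>
  define e where "e = (\<lambda>i. rec_nat (ccons 1 0) (\<lambda>_ y. ccons 0 y) i)"
  have "list_decode (e i) = replicate i 0 @ [1]" for i
    unfolding e_def by (induction i) simp_all
  then have "decode_monom (e i) = Poly_Mapping.single i 1" for i
    by (simp add: decode_monom_def)
  moreover have "int_decode 2 = 1" using int_decode_even_odd(1)[of 1] by simp
  moreover have "recursive_fun (\<lambda>x. e (f x))"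
    unfolding e_def by (intro rf_rec_nat rf_ccons rf_intros f)
  ultimately show ?thesis using poly_recursive_single[of "\<lambda>x. e (f x)" "\<lambda>x. 2"]
    by (simp add: mpoly_var_def rf_const)
qed

lemmas poly_recursive_intros = poly_recursive_add poly_recursive_mult poly_recursive_diff
  poly_recursive_numeral poly_recursive_var poly_recursive_int_decode poly_recursive_decode

lemma poly_recursive_prod:
  assumes "poly_recursive (\<lambda>w. G (cfst w) (csnd w))" "recursive_fun n"
  shows "poly_recursive (\<lambda>x. \<Prod>i<n x. G x i)"
proof -
  have "rec_nat 1 (\<lambda>k y. y * G x k) m = (\<Prod>i<m. G x i)" for x m
    by (induction m) auto
  moreover have "poly_recursive (\<lambda>x. rec_nat 1 (\<lambda>k y. y * G x k) (n x))"
  proof (rule poly_recursive_rec_nat[OF poly_recursive_numeral(2) _ assms(2)])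
    have "poly_recursive (\<lambda>w. G (cfst w) (cfst (csnd w)))"
      using poly_recursive_comp[OF assms(1), of "\<lambda>w. prod_encode (cfst w, cfst (csnd w))"]
      by (simp add: rf_intros)
    then show "poly_recursive (\<lambda>w. decode_mpoly (csnd (csnd w)) * G (cfst w) (cfst (csnd w)))"
      by (intro poly_recursive_mult poly_recursive_decode rf_intros)
  qed
  ultimately show ?thesis by simp
qed

lemma poly_recursive_bound_prod:
  assumes "recursive_fun n"
  shows "poly_recursive (\<lambda>x. bound_prod mpoly_var (n x))"
proof -
  have "bound_prod mpoly_var m = rec_nat 1 (\<lambda>i y. y * (1 + 2 * (mpoly_var i * mpoly_var i))) m" for m
    by (induction m) auto
  then show ?thesis
    by (simp only:) (intro poly_recursive_rec_nat poly_recursive_intros rf_intros assms)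
qed

lemma poly_recursive_digits:
  assumes "poly_recursive w" "recursive_fun n"
  shows "poly_recursive (\<lambda>x. digits (w x) mpoly_var (n x))"
proof -
  have "digits v mpoly_var m = rec_nat 0 (\<lambda>i y. y * v + mpoly_var i) m" for v m
    by (induction m) auto
  then show ?thesis
    by (simp only:) (intro poly_recursive_rec_nat poly_recursive_intros rf_intros
      poly_recursive_comp[OF assms(1)] assms)
qed

lemma poly_recursive_tower:
  assumes "poly_recursive d" "poly_recursive q" "recursive_fun n"
  shows "poly_recursive (\<lambda>x. tower (d x) (q x) (n x))"
proof -
  have "tower d q m = rec_nat d (\<lambda>i y. 4 * y * (1 + q * y)) m" for d q :: int_mpoly and m
    by (induction m) auto
  then show ?thesis
    by (simp only:) (intro poly_recursive_rec_nat poly_recursive_intros rf_intros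
      poly_recursive_comp[OF assms(2)] assms)
qed

lemma poly_recursive_core_poly:
  assumes "poly_recursive d" "recursive_fun n" "poly_recursive N" "poly_recursive u"
    "poly_recursive k" "poly_recursive j"
  shows "poly_recursive (\<lambda>x. core_poly (d x) (n x) mpoly_var (N x) (u x) (k x) (j x))"
  unfolding core_poly_def Let_def
  by (intro poly_recursive_add poly_recursive_mult poly_recursive_diff poly_recursive_numeral
      poly_recursive_bound_prod poly_recursive_digits poly_recursive_tower rf_Suc assms)

section \<open>The equivalence\<close>

lemma eval_mpoly_closed:
  assumes S: "\<And>c. of_int c \<in> S" "\<And>x y. x \<in> S \<Longrightarrow> y \<in> S \<Longrightarrow> x + y \<in> S" "\<And>x y. x \<in> S \<Longrightarrow> y \<in> S \<Longrightarrow> x * y \<in> S"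
    and p: "p \<in> int_polys n" and xs: "\<And>i. i < n \<Longrightarrow> xs ! i \<in> S"
  shows "eval_mpoly p xs \<in> S"
proof -
  have S01: "0 \<in> S" "1 \<in> S" using S(1)[of 0] S(1)[of 1] by simp_all
  have pow: "x ^ k \<in> S" if "x \<in> S" for x k by (induction k) (auto intro: S01 S that)
  have prod: "prod f A \<in> S" if "\<And>i. i \<in> A \<Longrightarrow> f i \<in> S" for f :: "nat \<Rightarrow> complex" and A
    using that by (induction A rule: infinite_finite_induct) (auto intro: S01 S)
  have sum: "sum f A \<in> S" if "\<And>i. i \<in> A \<Longrightarrow> f i \<in> S" for f :: "(nat \<Rightarrow>\<^sub>0 nat) \<Rightarrow> complex" and A
    using that by (induction A rule: infinite_finite_induct) (auto intro: S01 S)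
  show ?thesis unfolding eval_mpoly_def
    by (intro sum S(3) S(1) prod pow xs) (use p in \<open>auto simp: int_polys_def\<close>)
qed

lemma eval_mpoly_append:
  assumes "p \<in> int_polys n" "length xs = n"
  shows "eval_mpoly p (xs @ ys) = eval_mpoly p xs"
  unfolding eval_mpoly_def
proof (intro sum.cong prod.cong refl arg_cong2[where f = "(*)"])
  fix e i assume "e \<in> Poly_Mapping.keys p" "i \<in> Poly_Mapping.keys e"
  then have "i < length xs" using assms by (auto simp: int_polys_def)
  then show "((xs @ ys) ! i) ^ Poly_Mapping.lookup e i = (xs ! i) ^ Poly_Mapping.lookup e i"
    by (simp add: nth_append)
qed

context quadratic_field begin

text \<open>In a real field -1 is no square. In an imaginary one, a root of 2 would be rational or a
  rational multiple of \<rho>, and the latter have squares that are not positive.\<close>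

definition nonsquare :: int where "nonsquare = (if D > 0 then -1 else 2)"

lemma nonsquare_not_square:
  assumes "x \<in> K"
  shows "x\<^sup>2 \<noteq> of_int nonsquare"
proof
  assume sq: "x\<^sup>2 = of_int nonsquare"
  obtain p q where x: "x = of_rat p + of_rat q * \<rho>" using assms K_coordinates by auto
  have "x\<^sup>2 = of_rat p * of_rat p + of_rat q * of_rat q * (\<rho> * \<rho>) + of_rat (2 * p * q) * \<rho>"
    unfolding x by (simp add: power2_eq_square algebra_simps of_rat_mult)
  then have "of_rat (p\<^sup>2 + q\<^sup>2 * of_int D) + of_rat (2 * p * q) * \<rho> = of_rat (of_int nonsquare) + of_rat 0 * \<rho>"
    using sq by (simp add: rho_mult of_rat_add of_rat_mult power2_eq_square)
  then have pq: "p\<^sup>2 + q\<^sup>2 * of_int D = of_int nonsquare" "2 * p * q = 0"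
    using independent[of "p\<^sup>2 + q\<^sup>2 * of_int D" "2 * p * q" "of_int nonsquare" 0] by simp_all
  then consider "q = 0" | "p = 0" by auto
  then show False
  proof cases
    case 1
    have "squarefree (2::int)" by (rule squarefree_prime) simp
    then have "p\<^sup>2 \<noteq> of_int 2" by (rule squarefree_neq_rat_square) auto
    moreover have "p\<^sup>2 \<noteq> -1" by (metis neg_0_le_iff_le not_one_le_zero zero_le_power2)
    ultimately show False using 1 pq by (auto simp: nonsquare_def split: if_splits)
  next
    case 2
    then have eq: "q\<^sup>2 * of_int D = of_int nonsquare" using pq by simp
    show False
    proof (cases "D > 0")
      case True
      then have "q\<^sup>2 * of_int D \<ge> 0" by simp
      then show False using eq True by (simp add: nonsquare_def)
    next
      case False
      then have "q\<^sup>2 * of_int D \<le> 0" by (simp add: mult_nonneg_nonpos)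
      then show False using eq False by (simp add: nonsquare_def)
    qed
  qed
qed

lemma anisotropic:
  assumes "x \<in> K" "y \<in> K" "x * x - of_int nonsquare * (y * y) = 0"
  shows "x = 0 \<and> y = 0"
proof -
  have "y = 0"
  proof (rule ccontr)
    assume "y \<noteq> 0"
    with assms(3) have "(x / y)\<^sup>2 = of_int nonsquare" by (simp add: power2_eq_square field_simps)
    moreover have "x / y \<in> K" using assms by (intro K_divide)
    ultimately show False using nonsquare_not_square by blast
  qed
  with assms show ?thesis by simp
qed

lemma eval_mpoly_OK:
  assumes "p \<in> int_polys n" "\<And>i. i < n \<Longrightarrow> xs ! i \<in> OK"
  shows "eval_mpoly p xs \<in> OK"
  using assms by (intro eval_mpoly_closed[of OK p n xs]) (auto intro: OK_intros)

text \<open>The anisotropic form separates \<open>C\<close> from \<open>Q\<close> over all of K. A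
  sum of squares separates the members of \<open>Ps\<close> only over the integers, but there it is
  used: the vanishing of \<open>C\<close> has already made the arguments integers.\<close>

lemma single_equation_equivalence:
  fixes Ps Rs :: "int_mpoly list"
  assumes Ps: "set Ps \<subseteq> int_polys (r + m)" and Rs: "set Rs \<subseteq> int_polys (r + m)"
  defines "n \<equiv> r + m"
  defines "C \<equiv> core_poly (of_int pell_d) n mpoly_var (\<Prod>i<length Rs. Rs ! i)
      (mpoly_var n) (mpoly_var (n + 1)) (mpoly_var (n + 2))"
  defines "Q \<equiv> (\<Sum>i<length Ps. Ps ! i * Ps ! i)"
  defines "H \<equiv> C * C - of_int nonsquare * (Q * Q)"
  assumes a: "a \<in> tuples OK r"
  shows "(\<exists>b \<in> tuples OK m. \<exists>u \<in> OK. \<exists>v \<in> OK. \<exists>j \<in> OK. eval_mpoly H (a @ b @ [u, v, j]) = 0) \<longleftrightarrow>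
    a \<in> tuples \<int> r \<and> (\<exists>b \<in> tuples \<int> m. (\<forall>P \<in> set Ps. eval_mpoly P (a @ b) = 0) \<and>
      (\<Prod>R\<leftarrow>Rs. eval_mpoly R (a @ b)) \<noteq> 0)"
proof -
  define Nv where "Nv = (\<lambda>zs. \<Prod>R\<leftarrow>Rs. eval_mpoly R zs)"
  define Qv where "Qv = (\<lambda>zs. \<Sum>i<length Ps. eval_mpoly (Ps ! i) zs * eval_mpoly (Ps ! i) zs)"
  have PR: "Ps ! i \<in> int_polys n" if "i < length Ps" for i using Ps that by (auto simp: n_def)
  have RR: "Rs ! i \<in> int_polys n" if "i < length Rs" for i using Rs that by (auto simp: n_def)
  have Nv: "Nv zs = (\<Prod>i<length Rs. eval_mpoly (Rs ! i) zs)" for zs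
    by (simp add: Nv_def prod.list_conv_set_nth atLeast0LessThan)
  have evalC: "eval_mpoly C (zs @ [u, v, j]) = core_poly (of_int pell_d) n (\<lambda>i. (zs @ [u, v, j]) ! i) (Nv zs) u v j"
    if "length zs = n" for zs u v j
  proof -
    have "(\<Prod>i<length Rs. eval_mpoly (Rs ! i) (zs @ [u, v, j])) = Nv zs"
      unfolding Nv by (intro prod.cong refl eval_mpoly_append[OF RR that]) simp
    then show ?thesis unfolding C_def eval_core_poly eval_mpoly_prod by (simp add: that nth_append)
  qed
  have evalQ: "eval_mpoly Q (zs @ [u, v, j]) = Qv zs" if "length zs = n" for zs u v j
    unfolding Q_def eval_mpoly_sum eval_mpoly_mult Qv_def
    by (intro sum.cong refl) (simp add: eval_mpoly_append[OF PR that])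
  have evalH: "eval_mpoly H xs = eval_mpoly C xs * eval_mpoly C xs - of_int nonsquare * (eval_mpoly Q xs * eval_mpoly Q xs)" for xs
    by (simp add: H_def eval_mpoly_hom)
  show ?thesis
  proof
    assume "\<exists>b \<in> tuples OK m. \<exists>u \<in> OK. \<exists>v \<in> OK. \<exists>j \<in> OK. eval_mpoly H (a @ b @ [u, v, j]) = 0"
    then obtain b u v j where b: "b \<in> tuples OK m" and uvj: "u \<in> OK" "v \<in> OK" "j \<in> OK"
      and H0: "eval_mpoly H ((a @ b) @ [u, v, j]) = 0" by auto
    define zs where "zs = a @ b"
    have len: "length zs = n" and zsOK: "set zs \<subseteq> OK" using a b by (auto simp: zs_def tuples_def n_def)
    have zOK: "(zs @ [u, v, j]) ! i \<in> OK" if "i < n + 3" for i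
    proof -
      have "set (zs @ [u, v, j]) \<subseteq> OK" using zsOK uvj by simp
      moreover have "i < length (zs @ [u, v, j])" using that len by simp
      ultimately show ?thesis using nth_mem by blast
    qed
    have CP: "C \<in> int_polys (n + 3)" unfolding C_def
      by (intro int_polys_core_poly int_polys_prod int_polys_of_int int_polys_var
          int_polys_mono[OF RR]) auto
    have QP: "Q \<in> int_polys (n + 3)" unfolding Q_def
      by (intro int_polys_sum int_polys_mult int_polys_mono[OF PR]) auto
    have CQ: "eval_mpoly C (zs @ [u, v, j]) = 0 \<and> eval_mpoly Q (zs @ [u, v, j]) = 0"
      using H0 unfolding evalH zs_def[symmetric]
      by (intro anisotropic OK_in_K eval_mpoly_OK[OF CP] eval_mpoly_OK[OF QP] zOK)
    have N: "Nv zs \<in> OK" unfolding Nv[of zs] eval_mpoly_prod[symmetric]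
      by (rule eval_mpoly_OK[OF int_polys_prod[OF RR]]) (use zsOK len in auto)
    have "core_poly (of_int pell_d) n (\<lambda>i. (zs @ [u, v, j]) ! i) (Nv zs) u v j = 0"
      using CQ evalC len by simp
    from core_poly_root[OF _ N uvj this] have res: "Nv zs \<noteq> 0" "\<forall>i<n. (zs @ [u, v, j]) ! i \<in> \<int>"
      using zOK by auto
    have zsZ: "zs ! i \<in> \<int>" if "i < n" for i using res(2) that len by (auto simp: nth_append)
    then have setZ: "set zs \<subseteq> \<int>" using len by (auto simp: in_set_conv_nth)
    have "eval_mpoly (Ps ! i) zs \<in> \<int>" if "i < length Ps" for i
      using zsZ by (intro eval_mpoly_closed[OF _ _ _ PR[OF that]]) auto
    then have "\<forall>i. \<exists>c. i < length Ps \<longrightarrow> eval_mpoly (Ps ! i) zs = of_int c" by (metis Ints_cases)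
    then obtain f where f: "\<And>i. i < length Ps \<Longrightarrow> eval_mpoly (Ps ! i) zs = of_int (f i)" by metis
    have "of_int (\<Sum>i<length Ps. f i * f i) = Qv zs" by (simp add: Qv_def f)
    also have "\<dots> = 0" using CQ evalQ len by simp
    finally have "(\<Sum>i<length Ps. f i * f i) = 0" by (simp only: of_int_eq_0_iff)
    then have "f i = 0" if "i < length Ps" for i
      using that by (subst (asm) sum_nonneg_eq_0_iff) auto
    then have "\<forall>P \<in> set Ps. eval_mpoly P zs = 0" using f by (auto simp: in_set_conv_nth)
    moreover have "a \<in> tuples \<int> r" "b \<in> tuples \<int> m"
      using a b setZ by (auto simp: tuples_def zs_def)
    ultimately show "a \<in> tuples \<int> r \<and> (\<exists>b \<in> tuples \<int> m. (\<forall>P \<in> set Ps. eval_mpoly P (a @ b) = 0) \<and>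
        (\<Prod>R\<leftarrow>Rs. eval_mpoly R (a @ b)) \<noteq> 0)"
      using res(1) unfolding Nv_def zs_def by blast
  next
    assume "a \<in> tuples \<int> r \<and> (\<exists>b \<in> tuples \<int> m. (\<forall>P \<in> set Ps. eval_mpoly P (a @ b) = 0) \<and>
        (\<Prod>R\<leftarrow>Rs. eval_mpoly R (a @ b)) \<noteq> 0)"
    then obtain b where aZ: "a \<in> tuples \<int> r" and b: "b \<in> tuples \<int> m"
      and P0: "\<And>P. P \<in> set Ps \<Longrightarrow> eval_mpoly P (a @ b) = 0" and N0: "Nv (a @ b) \<noteq> 0"
      unfolding Nv_def by blast
    define zs where "zs = a @ b"
    have len: "length zs = n" and zsZ: "set zs \<subseteq> \<int>" using aZ b by (auto simp: zs_def tuples_def n_def)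
    have zi: "zs ! i \<in> \<int>" if "i < n" for i using zsZ len that by auto
    then have "\<forall>i. \<exists>c. i < n \<longrightarrow> zs ! i = of_int c" by (metis Ints_cases)
    then obtain z where z: "\<And>i. i < n \<Longrightarrow> zs ! i = of_int (z i)" by metis
    have "Nv zs \<in> \<int>" unfolding Nv[of zs] eval_mpoly_prod[symmetric]
      using zi by (intro eval_mpoly_closed[OF _ _ _ int_polys_prod[OF RR]]) auto
    then obtain N where N: "Nv zs = of_int N" by (elim Ints_cases)
    then have "N \<noteq> 0" using N0 by (auto simp: zs_def)
    then obtain u v j where uvj: "core_poly pell_d n z N u v j = 0" using core_poly_solvable by blast
    \<comment> \<open>From index \<open>n\<close> on, \<open>z\<close> is arbitrary while the list
      holds the auxiliary unknowns; both constructions read only the places below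
      \<open>n\<close>.\<close>
    have cong: "bound_prod x n = bound_prod x' n \<and> digits w x n = digits w x' n"
      if "\<And>i. i < n \<Longrightarrow> x i = x' i" for x x' :: "nat \<Rightarrow> complex" and w
      using that by (induction n) auto
    have "eval_mpoly C (zs @ [of_int u, of_int v, of_int j]) =
        core_poly (of_int pell_d) n (\<lambda>i. of_int (z i)) (of_int N) (of_int u) (of_int v) (of_int j)"
    proof -
      have c: "(zs @ [of_int u, of_int v, of_int j]) ! i = of_int (z i)" if "i < n" for i
        using that len z by (simp add: nth_append)
      show ?thesis unfolding evalC[OF len] N core_poly_def
        using cong[of "\<lambda>i. (zs @ [of_int u, of_int v, of_int j]) ! i" "\<lambda>i. of_int (z i)"] c by simp
    qed
    also have "\<dots> = 0" unfolding of_int_core_poly[symmetric] uvj by simp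
    finally have C0: "eval_mpoly C (zs @ [of_int u, of_int v, of_int j]) = 0" .
    have "Qv zs = 0" unfolding Qv_def by (rule sum.neutral) (use P0 in \<open>simp add: zs_def\<close>)
    then have "eval_mpoly H (zs @ [of_int u, of_int v, of_int j]) = 0"
      unfolding evalH C0 evalQ[OF len] by simp
    moreover have "b \<in> tuples OK m" using b OK_of_int unfolding tuples_def by (auto elim!: Ints_cases)
    ultimately show "\<exists>b \<in> tuples OK m. \<exists>u \<in> OK. \<exists>v \<in> OK. \<exists>j \<in> OK. eval_mpoly H (a @ b @ [u, v, j]) = 0"
      unfolding zs_def using OK_of_int by (metis append.assoc)
  qed
qed

end

section \<open>The construction as one recursive function of the coded input\<close>

definition pell_d_code :: "nat \<Rightarrow> nat" where
  "pell_d_code x = (if x mod 2 = 0 then x else int_encode 3)"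

definition nonsquare_code :: "nat \<Rightarrow> nat" where
  "nonsquare_code x = (if x mod 2 = 0 then int_encode (-1) else int_encode 2)"

text \<open>Defined on all numbers, as a total function requires. On codes made by
  \<open>encode_input\<close>, whose entries are read by position, it is the \<open>H\<close> of
  \<open>single_equation_equivalence\<close>.\<close>

definition combined_mpoly :: "nat \<Rightarrow> int_mpoly" where
  "combined_mpoly x =
    (let n = cnth x 1 + cnth x 2;
         N = \<Prod>i<cnth x 4. decode_mpoly (cnth (cnth x 6) i);
         Q = \<Sum>i<cnth x 3. decode_mpoly (cnth (cnth x 5) i) * decode_mpoly (cnth (cnth x 5) i);
         C = core_poly (of_int (int_decode (pell_d_code (cnth x 0)))) n mpoly_var N
               (mpoly_var n) (mpoly_var (n + 1)) (mpoly_var (n + 2))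
     in C * C - of_int (int_decode (nonsquare_code (cnth x 0))) * (Q * Q))"

lemma poly_recursive_combined_mpoly: "poly_recursive combined_mpoly"
  unfolding combined_mpoly_def[abs_def] Let_def pell_d_code_def nonsquare_code_def
  by (intro poly_recursive_add poly_recursive_mult poly_recursive_diff poly_recursive_core_poly
      poly_recursive_int_decode poly_recursive_prod poly_recursive_sum poly_recursive_decode
      poly_recursive_var rf_cnth rf_add rf_if_zero rf_mod2 rf_intros)

theorem theorem1p3:
  shows "\<exists>F. recursive_fun F \<and>
    (\<forall>K D r m s t Ps Rs.
       quadratic_number_field K \<and> squarefree D \<and> D \<noteq> 0 \<and> D \<noteq> 1 \<and> K = rat_adjoin_sqrt D \<and>
       length Ps = s \<and> set Ps \<subseteq> int_polys (r + m) \<and>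
       length Rs = t \<and> set Rs \<subseteq> int_polys (r + m) \<longrightarrow>
       (\<exists>H \<in> int_polys (r + m + 3).
          decode_mpoly (F (encode_input D r m s t Ps Rs)) = H \<and>
          (\<forall>a \<in> tuples (ring_of_integers K) r.
             (\<exists>b \<in> tuples (ring_of_integers K) m.
              \<exists>u \<in> ring_of_integers K. \<exists>v \<in> ring_of_integers K. \<exists>j \<in> ring_of_integers K.
                eval_mpoly H (a @ b @ [u, v, j]) = 0)
             \<longleftrightarrow>
             a \<in> tuples \<int> r \<and>
             (\<exists>b \<in> tuples \<int> m.
                (\<forall>P \<in> set Ps. eval_mpoly P (a @ b) = 0) \<and>
                (\<Prod>R\<leftarrow>Rs. eval_mpoly R (a @ b)) \<noteq> 0))))"
proof -
  obtain F where F: "recursive_fun F" "\<And>x. decode_mpoly (F x) = combined_mpoly x"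
    using poly_recursive_combined_mpoly unfolding poly_recursive_def by blast
  show ?thesis
  proof (intro exI[of _ F] conjI F(1) allI impI)
    fix K D r m s t and Ps Rs :: "int_mpoly list"
    assume asm: "quadratic_number_field K \<and> squarefree D \<and> D \<noteq> 0 \<and> D \<noteq> 1 \<and> K = rat_adjoin_sqrt D \<and>
       length Ps = s \<and> set Ps \<subseteq> int_polys (r + m) \<and>
       length Rs = t \<and> set Rs \<subseteq> int_polys (r + m)"
    then interpret quadratic_field D K
      by unfold_locales (auto simp: quadratic_number_field_def)
    define x where "x = encode_input D r m s t Ps Rs"
    define n where "n = r + m"
    define C where "C = core_poly (of_int pell_d) n mpoly_var (\<Prod>i<length Rs. Rs ! i)
      (mpoly_var n) (mpoly_var (n + 1)) (mpoly_var (n + 2))"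
    define Q where "Q = (\<Sum>i<length Ps. Ps ! i * Ps ! i)"
    define H where "H = C * C - of_int nonsquare * (Q * Q)"
    \<comment> \<open>\<open>int_encode\<close> assigns even codes to the nonnegative integers, so
      for nonzero \<open>D\<close> the parity of the code tests its sign.\<close>
    have par: "int_encode D mod 2 = (if D > 0 then 0 else 1)"
      using D_nonzero by (simp add: int_encode_def sum_encode_def)
    have codes: "int_decode (pell_d_code (int_encode D)) = pell_d"
      "int_decode (nonsquare_code (int_encode D)) = nonsquare"
      unfolding pell_d_code_def nonsquare_code_def pell_d_def nonsquare_def par by simp_all
    \<comment> \<open>The list entries are encodings of the given polynomials, which
      \<open>decode_mpoly\<close> recovers.\<close>
    have Pi: "decode_mpoly (cnth (list_encode (map encode_mpoly Ps)) i) = Ps ! i" if "i < length Ps" for i and Ps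
      using that by (simp add: cnth_list_encode decode_encode_mpoly)
    have xs: "cnth x 0 = int_encode D" "cnth x 1 = r" "cnth x 2 = m" "cnth x 3 = length Ps"
      "cnth x 4 = length Rs" "cnth x 5 = list_encode (map encode_mpoly Ps)"
      "cnth x 6 = list_encode (map encode_mpoly Rs)"
      using asm unfolding x_def encode_input_def
      by (simp_all add: cnth_list_encode del: list_encode.simps)
    have decoded: "(\<Prod>i<length Rs. decode_mpoly (cnth (list_encode (map encode_mpoly Rs)) i)) = (\<Prod>i<length Rs. Rs ! i)"
      "(\<Sum>i<length Ps. decode_mpoly (cnth (list_encode (map encode_mpoly Ps)) i) *
        decode_mpoly (cnth (list_encode (map encode_mpoly Ps)) i)) = (\<Sum>i<length Ps. Ps ! i * Ps ! i)"
      by (intro prod.cong sum.cong refl; simp add: Pi)+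
    have "decode_mpoly (F x) = H"
      unfolding F(2) combined_mpoly_def Let_def xs codes H_def C_def Q_def n_def
      unfolding decoded ..
    moreover have "H \<in> int_polys (n + 3)"
    proof -
      have PR: "Ps ! i \<in> int_polys n" if "i < length Ps" for i using asm that by (auto simp: n_def)
      have RR: "Rs ! i \<in> int_polys n" if "i < length Rs" for i using asm that by (auto simp: n_def)
      show ?thesis unfolding H_def C_def Q_def
        by (intro int_polys_diff int_polys_mult int_polys_core_poly int_polys_prod int_polys_sum
            int_polys_of_int int_polys_var int_polys_mono[OF RR] int_polys_mono[OF PR]) auto
    qed
    ultimately show "\<exists>H \<in> int_polys (r + m + 3).
          decode_mpoly (F (encode_input D r m s t Ps Rs)) = H \<and>
          (\<forall>a \<in> tuples (ring_of_integers K) r.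
             (\<exists>b \<in> tuples (ring_of_integers K) m.
              \<exists>u \<in> ring_of_integers K. \<exists>v \<in> ring_of_integers K. \<exists>j \<in> ring_of_integers K.
                eval_mpoly H (a @ b @ [u, v, j]) = 0)
             \<longleftrightarrow>
             a \<in> tuples \<int> r \<and>
             (\<exists>b \<in> tuples \<int> m.
                (\<forall>P \<in> set Ps. eval_mpoly P (a @ b) = 0) \<and>
                (\<Prod>R\<leftarrow>Rs. eval_mpoly R (a @ b)) \<noteq> 0))"
      using single_equation_equivalence[of Ps r m Rs] asm
      unfolding x_def H_def C_def Q_def n_def by blast
  qed
qed

end
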